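(* Let $P$ be a finite poset and let $\mathcal{C}=\{C_1,\dots,C_m\}$ be a nonempty subset of $\mathrm{MaxChain}(P)$ (with $m=\#\mathcal{C}$). Then: (1) $\mathrm{conv}(\mathcal{C})$ is an $(m-1)$-simplex and is a face of $\mathscr{M}(P)$ if and only if $\mathcal{C}$ does not have a guided crown structure. (2) $\mathrm{conv}(\mathcal{C})$ is not a simplex but is a face of $\mathscr{M}(P)$ if and only if $\mathcal{C}$ has a complete guided crown structure. (3) $\mathrm{conv}(\mathcal{C})$ is not a face of $\mathscr{M}(P)$ if and only if $\mathcal{C}$ has an incomplete guided crown structure.
   Context: Posets are finite; write $P=\{1,\dots,p\}$ for the underlying set of a poset with order relation $\le$. A chain is a subset in which any two elements are comparable; a maximal chain is a chain not contained in a larger chain; $\mathrm{MaxChain}(P)$ is the set of all maximal chains of $P$. Write $x\lessdot y$ if $y$ covers $x$, i.e. $x<y$ and there is no $z$ with $x<z<y$. Polytopes: for $Q\subset P$ let $e_Q=\sum_{x\in Q}e_x\in\mathbb{R}^p$, where $e_x$ is the standard unit vector. For a set $\mathcal{Q}$ of subsets of $P$, $\mathrm{conv}(\mathcal{Q})$ is the convex hull of $\{e_Q\mid Q\in\mathcal{Q}\}$. The maximal chain polytope is $\mathscr{M}(P)=\mathrm{conv}(\mathrm{MaxChain}(P))$. Faces of $\mathscr{M}(P)$ include $\mathscr{M}(P)$ itself. Intervals: for $Q\subset P$ and $x,y\in P$ put $(-\infty,x]_Q=\{z\in Q\mid z\le x\}$, $[x,\infty)_Q=\{z\in Q\mid z\ge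 x\}$, $(x,\infty)_Q=\{z\in Q\mid z>x\}$, $(x,y)_Q=\{z\in Q\mid x<z<y\}$. For $\mathcal{C}\subset\mathrm{MaxChain}(P)$ and $x,y\in P$ put $\mathcal{C}_{xy}=\{C\in\mathcal{C}\mid x,y\in C\}$. Guided crowns: for $\rho\ge 2$, a sequence $W=(\alpha_1,\beta_1,\dots,\alpha_\rho,\beta_\rho)$ of elements of $P$ is a guided ($\rho$-)crown of $\mathcal{C}$ if (with index $0$ identified with $\rho$) $\alpha_i\lessdot\beta_i$ and $\alpha_i\lessdot\beta_{i-1}$ for all $i\in\{1,\dots,\rho\}$; $\alpha_i\ne\alpha_j$ and $\beta_i\neq\beta_j$ for all distinct $i,j$; and $\mathcal{C}_{\alpha_i\beta_i}\neq\emptyset$ for all $i$. It is complete if for every $i\in\{1,\dots,\rho\}$ and all $C_i\in\mathcal{C}_{\alpha_i\beta_i}$, $C_{i-1}\in\mathcal{C}_{\alpha_{i-1}\beta_{i-1}}$ one has $(-\infty,\alpha_i]_{C_i}\cup[\beta_{i-1},\infty)_{C_{i-1}}\in\mathcal{C}$; otherwise it is incomplete. Guided stars: a sequence $(\alpha_1,\beta_1,\alpha_2,\beta_2)$ of elements of $P$ is a guided star of $\mathcal{C}$ if $\alpha_1,\alpha_2$ are incomparable, $\beta_1,\beta_2$ are incomparable, $\alpha_1<\beta_1$, $\alpha_2<\beta_2$, and there exist $C_1\in\mathcal{C}_{\alpha_1\beta_1}$, $C_2\in\mathcal{C}_{\alpha_2\beta_2}$ with $(\alpha_1,\beta_1)_{C_1}\cap(\alpha_2,\beta_2)_{C_2}\neq\emptyset$.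 It is complete if for all $C_1\in\mathcal{C}_{\alpha_1\beta_1}$, $C_2\in\mathcal{C}_{\alpha_2\beta_2}$ with $(\alpha_1,\beta_1)_{C_1}\cap(\alpha_2,\beta_2)_{C_2}\ne\emptyset$ and every $\gamma$ in this intersection, both $(-\infty,\gamma]_{C_1}\cup(\gamma,\infty)_{C_2}$ and $(-\infty,\gamma]_{C_2}\cup(\gamma,\infty)_{C_1}$ belong to $\mathcal{C}$; otherwise it is incomplete. $\mathcal{C}$ has a guided crown structure if it has at least one guided $\rho$-crown (for some $\rho\ge2$) or at least one guided star. If $\mathcal{C}$ has a guided crown structure, then it has a complete guided crown structure if every guided crown and every guided star of $\mathcal{C}$ is complete; otherwise (some guided crown or guided star of $\mathcal{C}$ is incomplete) it has an incomplete guided crown structure. *)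

theory Defs
  imports "HOL-Analysis.Analysis"
begin

text \<open>
  The finite poset \<open>P\<close> is the universe of a type \<open>'a\<close> of sort \<open>{finite, order}\<close>, so that
  \<open>\<real>\<^sup>p\<close> becomes \<open>real ^ 'a\<close> with unit vectors \<open>axis x 1\<close>. The intervals
  \<open>(-\<infinity>, x]\<^sub>Q\<close>, \<open>[x, \<infinity>)\<^sub>Q\<close>, \<open>(x, \<infinity>)\<^sub>Q\<close> and \<open>(x, y)\<^sub>Q\<close> are written
  \<open>Q \<inter> {..x}\<close>, \<open>Q \<inter> {x..}\<close>, \<open>Q \<inter> {x<..}\<close> and \<open>Q \<inter> {x<..<y}\<close>.
\<close>

definition max_chains :: "'a::order set set" where
  "max_chains = {C. pred_on.maxchain UNIV (<) C}"

definition covers :: "'a::order \<Rightarrow> 'a \<Rightarrow> bool" (infix "\<lessdot>" 50) where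
  "x \<lessdot> y \<longleftrightarrow> x < y \<and> \<not> (\<exists>z. x < z \<and> z < y)"

definition comparable :: "'a::order \<Rightarrow> 'a \<Rightarrow> bool" where
  "comparable x y \<longleftrightarrow> x \<le> y \<or> y \<le> x"

definition subset_vector :: "'a::finite set \<Rightarrow> real ^ 'a" where
  "subset_vector Q = (\<Sum>x\<in>Q. axis x 1)"

definition conv :: "'a::finite set set \<Rightarrow> (real ^ 'a) set" where
  "conv \<Q> = convex hull (subset_vector ` \<Q>)"

definition max_chain_polytope :: "(real ^ 'a::{finite,order}) set" where
  "max_chain_polytope = conv max_chains"

definition chains_through :: "'a set set \<Rightarrow> 'a \<Rightarrow> 'a \<Rightarrow> 'a set set" where
  "chains_through \<C> x y = {C \<in> \<C>. x \<in> C \<and> y \<in> C}"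


subsection \<open>Guided crowns\<close>

text \<open>
  A crown \<open>(\<alpha>\<^sub>1, \<beta>\<^sub>1, \<dots>, \<alpha>\<^sub>\<rho>, \<beta>\<^sub>\<rho>)\<close> is given by \<open>\<rho>\<close> and two functions on \<open>nat\<close>, of which only
  the values on \<open>{1..\<rho>}\<close> matter; the index \<open>0\<close> is identified with \<open>\<rho>\<close>.
\<close>

definition pred_index :: "nat \<Rightarrow> nat \<Rightarrow> nat" where
  "pred_index \<rho> i = (if i = 1 then \<rho> else i - 1)"

definition guided_crown ::
    "'a::order set set \<Rightarrow> nat \<Rightarrow> (nat \<Rightarrow> 'a) \<Rightarrow> (nat \<Rightarrow> 'a) \<Rightarrow> bool" where
  "guided_crown \<C> \<rho> \<alpha> \<beta> \<longleftrightarrow>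
     \<rho> \<ge> 2 \<and>
     (\<forall>i\<in>{1..\<rho>}. \<alpha> i \<lessdot> \<beta> i \<and> \<alpha> i \<lessdot> \<beta> (pred_index \<rho> i)) \<and>
     (\<forall>i\<in>{1..\<rho>}. \<forall>j\<in>{1..\<rho>}. i \<noteq> j \<longrightarrow> \<alpha> i \<noteq> \<alpha> j \<and> \<beta> i \<noteq> \<beta> j) \<and>
     (\<forall>i\<in>{1..\<rho>}. chains_through \<C> (\<alpha> i) (\<beta> i) \<noteq> {})"

definition crown_complete ::
    "'a::order set set \<Rightarrow> nat \<Rightarrow> (nat \<Rightarrow> 'a) \<Rightarrow> (nat \<Rightarrow> 'a) \<Rightarrow> bool" where
  "crown_complete \<C> \<rho> \<alpha> \<beta> \<longleftrightarrow>
     (\<forall>i\<in>{1..\<rho>}.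
        \<forall>C \<in> chains_through \<C> (\<alpha> i) (\<beta> i).
        \<forall>C' \<in> chains_through \<C> (\<alpha> (pred_index \<rho> i)) (\<beta> (pred_index \<rho> i)).
          (C \<inter> {..\<alpha> i}) \<union> (C' \<inter> {\<beta> (pred_index \<rho> i)..}) \<in> \<C>)"


subsection \<open>Guided stars\<close>

definition guided_star :: "'a::order set set \<Rightarrow> 'a \<Rightarrow> 'a \<Rightarrow> 'a \<Rightarrow> 'a \<Rightarrow> bool" where
  "guided_star \<C> \<alpha>\<^sub>1 \<beta>\<^sub>1 \<alpha>\<^sub>2 \<beta>\<^sub>2 \<longleftrightarrow>
     \<not> comparable \<alpha>\<^sub>1 \<alpha>\<^sub>2 \<and> \<not> comparable \<beta>\<^sub>1 \<beta>\<^sub>2 \<and> \<alpha>\<^sub>1 < \<beta>\<^sub>1 \<and> \<alpha>\<^sub>2 < \<beta>\<^sub>2 \<and>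
     (\<exists>C\<^sub>1 \<in> chains_through \<C> \<alpha>\<^sub>1 \<beta>\<^sub>1. \<exists>C\<^sub>2 \<in> chains_through \<C> \<alpha>\<^sub>2 \<beta>\<^sub>2.
        (C\<^sub>1 \<inter> {\<alpha>\<^sub>1<..<\<beta>\<^sub>1}) \<inter> (C\<^sub>2 \<inter> {\<alpha>\<^sub>2<..<\<beta>\<^sub>2}) \<noteq> {})"

definition star_complete :: "'a::order set set \<Rightarrow> 'a \<Rightarrow> 'a \<Rightarrow> 'a \<Rightarrow> 'a \<Rightarrow> bool" where
  "star_complete \<C> \<alpha>\<^sub>1 \<beta>\<^sub>1 \<alpha>\<^sub>2 \<beta>\<^sub>2 \<longleftrightarrow>
     (\<forall>C\<^sub>1 \<in> chains_through \<C> \<alpha>\<^sub>1 \<beta>\<^sub>1. \<forall>C\<^sub>2 \<in> chains_through \<C> \<alpha>\<^sub>2 \<beta>\<^sub>2.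
        \<forall>\<gamma> \<in> (C\<^sub>1 \<inter> {\<alpha>\<^sub>1<..<\<beta>\<^sub>1}) \<inter> (C\<^sub>2 \<inter> {\<alpha>\<^sub>2<..<\<beta>\<^sub>2}).
          (C\<^sub>1 \<inter> {..\<gamma>}) \<union> (C\<^sub>2 \<inter> {\<gamma><..}) \<in> \<C> \<and>
          (C\<^sub>2 \<inter> {..\<gamma>}) \<union> (C\<^sub>1 \<inter> {\<gamma><..}) \<in> \<C>)"


subsection \<open>Guided crown structures\<close>

definition guided_crown_structure :: "'a::order set set \<Rightarrow> bool" where
  "guided_crown_structure \<C> \<longleftrightarrow>
     (\<exists>\<rho> \<alpha> \<beta>. guided_crown \<C> \<rho> \<alpha> \<beta>) \<or> (\<exists>\<alpha>\<^sub>1 \<beta>\<^sub>1 \<alpha>\<^sub>2 \<beta>\<^sub>2. guided_star \<C> \<alpha>\<^sub>1 \<beta>\<^sub>1 \<alpha>\<^sub>2 \<beta>\<^sub>2)"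

definition complete_guided_crown_structure :: "'a::order set set \<Rightarrow> bool" where
  "complete_guided_crown_structure \<C> \<longleftrightarrow>
     guided_crown_structure \<C> \<and>
     (\<forall>\<rho> \<alpha> \<beta>. guided_crown \<C> \<rho> \<alpha> \<beta> \<longrightarrow> crown_complete \<C> \<rho> \<alpha> \<beta>) \<and>
     (\<forall>\<alpha>\<^sub>1 \<beta>\<^sub>1 \<alpha>\<^sub>2 \<beta>\<^sub>2. guided_star \<C> \<alpha>\<^sub>1 \<beta>\<^sub>1 \<alpha>\<^sub>2 \<beta>\<^sub>2 \<longrightarrow> star_complete \<C> \<alpha>\<^sub>1 \<beta>\<^sub>1 \<alpha>\<^sub>2 \<beta>\<^sub>2)"

definition incomplete_guided_crown_structure :: "'a::order set set \<Rightarrow> bool" where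
  "incomplete_guided_crown_structure \<C> \<longleftrightarrow>
     guided_crown_structure \<C> \<and> \<not> complete_guided_crown_structure \<C>"

end

theory Submission
  imports Defs
begin

text \<open>
  Call two equally large families of chains that use each element of the poset equally often an
  exchange: they have the same barycentre. Both kinds of guided structure describe exchanges.
  At an element \<open>\<gamma>\<close> common to two chains the parts above \<open>\<gamma>\<close> can be swapped (a star), and along a
  crown \<open>\<alpha>\<^sub>i \<lessdot> \<beta>\<^sub>i\<close>, \<open>\<alpha>\<^sub>i \<lessdot> \<beta>\<^sub>i\<^sub>-\<^sub>1\<close> the part of \<open>C\<^sub>i\<close> up to \<open>\<alpha>\<^sub>i\<close> can be continued with the part of
  \<open>C\<^sub>i\<^sub>-\<^sub>1\<close> from \<open>\<beta>\<^sub>i\<^sub>-\<^sub>1\<close> on. If a result of the exchange leaves \<open>\<C>\<close>, then a point of \<open>conv \<C>\<close> is a convex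
  combination using a vertex outside \<open>conv \<C>\<close>, so that \<open>conv \<C>\<close> is not a face. If all results stay in
  \<open>\<C>\<close>, the exchange is a nontrivial affine relation between the vertices of \<open>conv \<C>\<close>, which is
  therefore no simplex.

  Conversely, consider a linear relation \<open>(\<Sum>Q\<in>\<Q>. \<nu> Q *\<^sub>R subset_vector Q) = 0\<close> between chains whose
  negative coefficients all belong to members of \<open>\<C>\<close>. It induces weights on the covering pairs
  (\<open>edge_flow\<close>), the weight of \<open>x \<lessdot> y\<close> being the
  sum of \<open>\<nu> Q\<close> over the chains through \<open>x\<close> and \<open>y\<close>. As the total weight at each element vanishes, the
  matrix of these weights has vanishing row and column sums. In such a matrix each positive entry
  lies on a cycle of alternating signs (\<open>alternating_cycle\<close>), and this cycle is a crown, guided by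
  the chains of negative weight (\<open>positive_edge_in_guided_crown\<close>).

  If all crowns and stars are complete, no positive weight can therefore sit on a covering pair
  that \<open>\<C>\<close> does not use. Hence a chain of positive weight outside \<open>\<C>\<close> would be made up of covering
  pairs used by \<open>\<C>\<close>, and because \<open>\<C>\<close> is closed under swaps it would lie in \<open>\<C>\<close> after all
  (\<open>max_chain_mem_if_covers_used\<close>). So \<open>conv \<C>\<close> is a face. If there are no crowns, the edge flow of
  a relation within \<open>\<C>\<close> vanishes entirely. If there are no stars either, each chain of \<open>\<C>\<close> owns an
  element or a covering pair that no other chain of \<open>\<C>\<close> contains (\<open>private_vertex_or_edge\<close>), and
  its coefficient is the flow there, namely zero. So the vertices are affinely independent.
\<close>

section \<open>Alternating cycles in matrices with vanishing margins\<close>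

text \<open>
  From the row \<open>a\<close>, move along a negative entry to a column and from there along a positive entry
  to a row, and so on. If \<open>b\<close> were never reached, let \<open>R\<close> and \<open>N\<close> be the rows and columns reached:
  the block \<open>R \<times> -N\<close> is nonnegative with the positive entry at \<open>(a, b)\<close>, the block \<open>-R \<times> N\<close> is
  nonpositive, and the vanishing margins force the two blocks to have the same sum. A shortest
  walk to \<open>b\<close> repeats no row and no column, and the entry \<open>(a, b)\<close> closes it up.
\<close>

lemma alternating_cycle:
  fixes h :: "'a::finite \<Rightarrow> 'b::finite \<Rightarrow> real"
  assumes rows: "\<And>x. (\<Sum>y\<in>UNIV. h x y) = 0" and cols: "\<And>y. (\<Sum>x\<in>UNIV. h x y) = 0"
    and pos: "h a b > 0"
  obtains \<rho> \<alpha> \<beta> where "\<rho> \<ge> 2" "\<alpha> 1 = a" "\<beta> \<rho> = b"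
    "\<And>i. i \<in> {1..\<rho>} \<Longrightarrow> h (\<alpha> i) (\<beta> i) < 0"
    "\<And>i. i \<in> {1..\<rho>} \<Longrightarrow> h (\<alpha> i) (\<beta> (pred_index \<rho> i)) > 0"
    "inj_on \<alpha> {1..\<rho>}" "inj_on \<beta> {1..\<rho>}"
proof -
  define walk where "walk n u v \<longleftrightarrow> u 0 = a \<and> (\<forall>k\<le>n. h (u k) (v k) < 0)
      \<and> (\<forall>k<n. h (u (Suc k)) (v k) > 0)" for n and u :: "nat \<Rightarrow> 'a" and v :: "nat \<Rightarrow> 'b"
  define N where "N = {y. \<exists>n u v. walk n u v \<and> v n = y}"
  define R where "R = {x. x = a \<or> (\<exists>y\<in>N. h x y > 0)}"
  have neg_closed: "y \<in> N" if x: "x \<in> R" and neg: "h x y < 0" for x y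
  proof (cases "x = a")
    case True
    then have "walk 0 (\<lambda>_. a) (\<lambda>_. y)" using neg by (simp add: walk_def)
    then show ?thesis unfolding N_def by blast
  next
    case False
    then obtain y' where y': "y' \<in> N" "h x y' > 0" using x by (auto simp: R_def)
    then obtain n u v where w: "walk n u v" "v n = y'" by (auto simp: N_def)
    have "walk (Suc n) (u(Suc n := x)) (v(Suc n := y))"
      using w y' neg by (auto simp: walk_def le_Suc_eq less_Suc_eq)
    then show ?thesis unfolding N_def by fastforce
  qed
  have "b \<in> N"
  proof (rule ccontr)
    assume b: "b \<notin> N"
    have "a \<in> R" by (simp add: R_def)
    have "(\<Sum>x\<in>R. \<Sum>y\<in>-N. h x y) > 0"
    proof (rule sum_pos2[OF finite \<open>a \<in> R\<close>])
      show "(\<Sum>y\<in>-N. h a y) > 0"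
        using b pos neg_closed[OF \<open>a \<in> R\<close>] by (intro sum_pos2[of _ b]) (auto intro: leI)
      show "(\<Sum>y\<in>-N. h x y) \<ge> 0" if "x \<in> R" for x
        using neg_closed[OF that] by (intro sum_nonneg) (auto intro: leI)
    qed
    moreover have "(\<Sum>x\<in>-R. \<Sum>y\<in>N. h x y) \<le> 0"
      by (intro sum_nonpos) (auto simp: R_def intro: leI)
    moreover have "(\<Sum>x\<in>R. \<Sum>y\<in>N. h x y) + (\<Sum>x\<in>R. \<Sum>y\<in>-N. h x y) = 0"
    proof -
      have "(\<Sum>y\<in>N. h x y) + (\<Sum>y\<in>-N. h x y) = 0" for x
        using rows[of x] sum.subset_diff[of N UNIV "h x"] by (simp add: Compl_eq_Diff_UNIV)
      then show ?thesis by (simp flip: sum.distrib)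
    qed
    moreover have "(\<Sum>x\<in>R. \<Sum>y\<in>N. h x y) + (\<Sum>x\<in>-R. \<Sum>y\<in>N. h x y) = 0"
    proof -
      have "(\<Sum>x\<in>R. h x y) + (\<Sum>x\<in>-R. h x y) = 0" for y
        using cols[of y] sum.subset_diff[of R UNIV "\<lambda>x. h x y"] by (simp add: Compl_eq_Diff_UNIV)
      then have "(\<Sum>y\<in>N. (\<Sum>x\<in>R. h x y) + (\<Sum>x\<in>-R. h x y)) = 0" by simp
      then show ?thesis by (simp add: sum.distrib sum.swap[of _ N])
    qed
    ultimately show False by linarith
  qed
  then have "\<exists>n. \<exists>u v. walk n u v \<and> v n = b" by (auto simp: N_def)
  then obtain n where "\<exists>u v. walk n u v \<and> v n = b"
    and short: "\<And>m. m < n \<Longrightarrow> \<not> (\<exists>u v. walk m u v \<and> v m = b)"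
    using exists_least_iff[of "\<lambda>n. \<exists>u v. walk n u v \<and> v n = b"] by blast
  then obtain u v where w: "walk n u v" "v n = b" by blast
  \<comment> \<open>A repeated row or column allows the piece of length \<open>d\<close> in between to be cut out.\<close>
  have u_inj: False if "i < j" "j \<le> n" "u i = u j" for i j
  proof -
    define d where "d = j - i"
    define u' where "u' k = (if k < i then u k else u (k + d))" for k
    define v' where "v' k = (if k < i then v k else v (k + d))" for k
    have "h (u' (Suc k)) (v' k) > 0" if "k < n - d" for k
    proof (cases "Suc k = i")
      case True
      moreover have "u' i = u i" "v' k = v k"
        using True \<open>u i = u j\<close> \<open>i < j\<close> by (auto simp: u'_def v'_def d_def)
      moreover have "k < n" using that by simp
      ultimately show ?thesis using w by (auto simp: walk_def)
    next
      case False
      then show ?thesis using w that by (auto simp: u'_def v'_def d_def walk_def)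
    qed
    moreover have "h (u' k) (v' k) < 0" if "k \<le> n - d" for k
      using w that \<open>i < j\<close> \<open>j \<le> n\<close> by (auto simp: u'_def v'_def d_def walk_def)
    moreover have "u' 0 = a"
      using w \<open>u i = u j\<close> \<open>i < j\<close> by (cases "i = 0") (auto simp: u'_def d_def walk_def)
    ultimately have "walk (n - d) u' v'" by (simp add: walk_def)
    moreover have "v' (n - d) = b" using w that by (auto simp: v'_def d_def)
    moreover have "n - d < n" using that by (auto simp: d_def)
    ultimately show False using short by blast
  qed
  have v_inj: False if "i < j" "j \<le> n" "v i = v j" for i j
  proof -
    define d where "d = j - i"
    define u' where "u' k = (if k \<le> i then u k else u (k + d))" for k
    define v' where "v' k = (if k \<le> i then v k else v (k + d))" for k
    have "h (u' (Suc k)) (v' k) > 0" if "k < n - d" for k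
    proof (cases "k = i")
      case True
      then have "j < n" "u' (Suc k) = u (Suc j)" "v' k = v j"
        using that \<open>i < j\<close> \<open>v i = v j\<close> by (auto simp: u'_def v'_def d_def)
      then show ?thesis using w by (auto simp: walk_def)
    next
      case False
      then show ?thesis using w that by (auto simp: u'_def v'_def d_def walk_def)
    qed
    moreover have "h (u' k) (v' k) < 0" if "k \<le> n - d" for k
      using w that \<open>i < j\<close> \<open>j \<le> n\<close> by (auto simp: u'_def v'_def d_def walk_def)
    moreover have "u' 0 = a"
      using w by (auto simp: u'_def walk_def)
    ultimately have "walk (n - d) u' v'" by (simp add: walk_def)
    moreover have "v' (n - d) = b"
      using w that by (cases "j = n") (auto simp: v'_def d_def)
    moreover have "n - d < n" using that by (auto simp: d_def)
    ultimately show False using short by blast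
  qed
  show ?thesis
  \<comment> \<open>The walk starts at index \<open>0\<close>, the cycle at index \<open>1\<close>.\<close>
  proof (rule that[of "Suc n" "\<lambda>i. u (i - 1)" "\<lambda>i. v (i - 1)"])
    show "2 \<le> Suc n" using w pos by (cases n) (auto simp: walk_def)
    show "u (1 - 1) = a" "v (Suc n - 1) = b" using w by (auto simp: walk_def)
    show "h (u (i - 1)) (v (i - 1)) < 0" if "i \<in> {1..Suc n}" for i
      using w that by (auto simp: walk_def)
    show "h (u (i - 1)) (v (pred_index (Suc n) i - 1)) > 0" if "i \<in> {1..Suc n}" for i
    proof (cases "i = 1")
      case True
      then show ?thesis using w pos by (simp add: pred_index_def walk_def)
    next
      case False
      then have "i = Suc (Suc (i - 2))" using that by auto
      then obtain k where "i = Suc (Suc k)" by blast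
      moreover have "h (u (Suc k)) (v k) > 0" using w that calculation by (simp add: walk_def)
      ultimately show ?thesis by (simp add: pred_index_def)
    qed
    show "inj_on (\<lambda>i. u (i - 1)) {1..Suc n}"
    proof (rule linorder_inj_onI)
      fix i j :: nat assume "i < j" "i \<in> {1..Suc n}" "j \<in> {1..Suc n}"
      then show "u (i - 1) \<noteq> u (j - 1)" using u_inj[of "i - 1" "j - 1"] by (cases i; cases j) auto
    qed auto
    show "inj_on (\<lambda>i. v (i - 1)) {1..Suc n}"
    proof (rule linorder_inj_onI)
      fix i j :: nat assume "i < j" "i \<in> {1..Suc n}" "j \<in> {1..Suc n}"
      then show "v (i - 1) \<noteq> v (j - 1)" using v_inj[of "i - 1" "j - 1"] by (cases i; cases j) auto
    qed auto
  qed
qed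

section \<open>Maximal chains\<close>

lemma max_chains_iff:
  "C \<in> max_chains \<longleftrightarrow>
     (\<forall>x\<in>C. \<forall>y\<in>C. x \<le> y \<or> y \<le> x) \<and> (\<forall>z. (\<forall>x\<in>C. x \<le> z \<or> z \<le> x) \<longrightarrow> z \<in> C)"
  (is "_ \<longleftrightarrow> ?chain \<and> ?max")
proof
  assume "C \<in> max_chains"
  then have chain: "pred_on.chain UNIV (<) C"
    and max: "\<And>S. pred_on.chain UNIV (<) S \<Longrightarrow> \<not> C \<subset> S"
    by (auto simp: max_chains_def pred_on.maxchain_def)
  have ?chain using chain by (fastforce simp: pred_on.chain_def)
  moreover have "z \<in> C" if "\<forall>x\<in>C. x \<le> z \<or> z \<le> x" for z
  proof -
    have "pred_on.chain UNIV (<) (insert z C)"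
      using chain that by (auto simp: pred_on.chain_def order_le_less)
    then show ?thesis using max[of "insert z C"] by blast
  qed
  ultimately show "?chain \<and> ?max" by blast
next
  assume *: "?chain \<and> ?max"
  then have "\<forall>x\<in>C. \<forall>y\<in>C. x \<le> y \<or> y \<le> x" by blast
  then have "pred_on.chain UNIV (<) C" by (auto simp: pred_on.chain_def order_le_less)
  moreover have "\<not> C \<subset> S" if "pred_on.chain UNIV (<) S" for S
  proof
    assume "C \<subset> S"
    then obtain z where "z \<in> S" "z \<notin> C" "C \<subseteq> S" by blast
    then have "\<forall>x\<in>C. x < z \<or> x = z \<or> z < x"
      using that unfolding pred_on.chain_def by blast
    then have "\<forall>x\<in>C. x \<le> z \<or> z \<le> x" by (auto simp: order_le_less)
    then show False using * \<open>z \<notin> C\<close> by blast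
  qed
  ultimately show "C \<in> max_chains"
    by (auto simp: max_chains_def pred_on.maxchain_def)
qed

lemma max_chain_comparable: "C \<in> max_chains \<Longrightarrow> x \<in> C \<Longrightarrow> y \<in> C \<Longrightarrow> x \<le> y \<or> y \<le> x"
  unfolding max_chains_iff by blast

lemma max_chain_mem: "C \<in> max_chains \<Longrightarrow> (\<And>x. x \<in> C \<Longrightarrow> x \<le> z \<or> z \<le> x) \<Longrightarrow> z \<in> C"
  unfolding max_chains_iff by blast

lemma max_chain_nonempty: "C \<in> max_chains \<Longrightarrow> C \<noteq> {}"
  unfolding max_chains_iff by blast

text \<open>
  An element comparable with both \<open>a\<close> and \<open>b\<close> cannot lie strictly between them. It is therefore
  below \<open>a\<close> or above \<open>b\<close>, and comparability with one half of the splice extends to the whole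
  chain which that half comes from.
\<close>

lemma splice_max_chain:
  assumes C: "C \<in> max_chains" "a \<in> C" and C': "C' \<in> max_chains" "b \<in> C'"
    and ab: "a = b \<or> a \<lessdot> b"
  shows "(C \<inter> {..a}) \<union> (C' \<inter> {b..}) \<in> max_chains"
proof -
  have "a \<le> b" using ab by (auto simp: covers_def)
  have gap: "z \<le> a \<or> b \<le> z" if "z \<le> a \<or> a \<le> z" "z \<le> b \<or> b \<le> z" for z
    using that ab by (auto simp: covers_def order_le_less)
  show ?thesis
    unfolding max_chains_iff
  proof (intro conjI ballI allI impI)
    fix x y assume "x \<in> C \<inter> {..a} \<union> C' \<inter> {b..}" "y \<in> C \<inter> {..a} \<union> C' \<inter> {b..}"
    then show "x \<le> y \<or> y \<le> x"
      using max_chain_comparable[OF C(1), of x y] max_chain_comparable[OF C'(1), of x y] \<open>a \<le> b\<close>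
      by (auto intro: order_trans)
  next
    fix z assume z: "\<forall>x\<in>C \<inter> {..a} \<union> C' \<inter> {b..}. x \<le> z \<or> z \<le> x"
    have "z \<le> a \<or> b \<le> z" using z C C' by (intro gap) auto
    then show "z \<in> C \<inter> {..a} \<union> C' \<inter> {b..}"
    proof
      assume "z \<le> a"
      have "x \<le> z \<or> z \<le> x" if "x \<in> C" for x
        using z that max_chain_comparable[OF C(1) that C(2)] \<open>z \<le> a\<close> by (auto intro: order_trans)
      then show ?thesis using max_chain_mem[OF C(1)] \<open>z \<le> a\<close> by blast
    next
      assume "b \<le> z"
      have "x \<le> z \<or> z \<le> x" if "x \<in> C'" for x
        using z that max_chain_comparable[OF C'(1) that C'(2)] \<open>b \<le> z\<close> by (auto intro: order_trans)
      then show ?thesis using max_chain_mem[OF C'(1)] \<open>b \<le> z\<close> by blast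
    qed
  qed
qed

lemma max_chain_split:
  assumes "C \<in> max_chains" "a \<in> C" "b \<in> C" "a \<lessdot> b"
  shows "C = (C \<inter> {..a}) \<union> (C \<inter> {b..})"
proof -
  have "x \<le> a \<or> b \<le> x" if "x \<in> C" for x
    using max_chain_comparable[OF assms(1) that assms(2)]
      max_chain_comparable[OF assms(1) that assms(3)] assms(4)
    by (auto simp: covers_def order_le_less)
  then show ?thesis by auto
qed

text \<open>
  The least element of \<open>C\<close> above \<open>a\<close> covers \<open>a\<close> in the whole poset, since anything in between would
  be comparable with all of \<open>C\<close>.
\<close>

lemma max_chain_upper_cover:
  fixes C :: "'a::{finite,order} set"
  assumes C: "C \<in> max_chains" "a \<in> C" and "a < z"
  obtains b where "b \<in> C" "a \<lessdot> b"
proof -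
  have "\<exists>x\<in>C. a < x"
  proof (rule ccontr)
    assume "\<not> (\<exists>x\<in>C. a < x)"
    then have "x \<le> a" if "x \<in> C" for x
      using max_chain_comparable[OF C(1) that C(2)] that by (auto simp: order_le_less)
    then have "z \<in> C" using \<open>a < z\<close> by (intro max_chain_mem[OF C(1)]) (meson order_le_less_trans order_le_less)
    then show False using \<open>\<not> (\<exists>x\<in>C. a < x)\<close> \<open>a < z\<close> by blast
  qed
  then have "{x \<in> C. a < x} \<noteq> {}" by blast
  then obtain b where b: "b \<in> C" "a < b" and min: "\<And>x. x \<in> C \<Longrightarrow> a < x \<Longrightarrow> \<not> x < b"
    using finite_has_minimal[of "{x \<in> C. a < x}"] by (auto simp: order_le_less)
  have False if "a < y" "y < b" for y
  proof -
    have "x \<le> y \<or> y \<le> x" if "x \<in> C" for x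
      using max_chain_comparable[OF C(1) that C(2)] max_chain_comparable[OF C(1) that b(1)]
        min[OF that] \<open>a < y\<close> \<open>y < b\<close> by (auto simp: order_le_less dest: order_less_trans)
    then have "y \<in> C" by (rule max_chain_mem[OF C(1)])
    then show False using min that by blast
  qed
  then show ?thesis using b that by (auto simp: covers_def)
qed

lemma max_chain_lower_cover:
  fixes C :: "'a::{finite,order} set"
  assumes C: "C \<in> max_chains" "b \<in> C" and "z < b"
  obtains a where "a \<in> C" "a \<lessdot> b"
proof -
  have "\<exists>x\<in>C. x < b"
  proof (rule ccontr)
    assume "\<not> (\<exists>x\<in>C. x < b)"
    then have "b \<le> x" if "x \<in> C" for x
      using max_chain_comparable[OF C(1) that C(2)] that by (auto simp: order_le_less)
    then have "z \<in> C" using \<open>z < b\<close> by (intro max_chain_mem[OF C(1)]) (meson order_less_le_trans order_le_less)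
    then show False using \<open>\<not> (\<exists>x\<in>C. x < b)\<close> \<open>z < b\<close> by blast
  qed
  then have "{x \<in> C. x < b} \<noteq> {}" by blast
  then obtain a where a: "a \<in> C" "a < b" and max: "\<And>x. x \<in> C \<Longrightarrow> x < b \<Longrightarrow> \<not> a < x"
    using finite_has_maximal[of "{x \<in> C. x < b}"] by (auto simp: order_le_less)
  have False if "a < y" "y < b" for y
  proof -
    have "x \<le> y \<or> y \<le> x" if "x \<in> C" for x
      using max_chain_comparable[OF C(1) that C(2)] max_chain_comparable[OF C(1) that a(1)]
        max[OF that] \<open>a < y\<close> \<open>y < b\<close> by (auto simp: order_le_less dest: order_less_trans)
    then have "y \<in> C" by (rule max_chain_mem[OF C(1)])
    then show False using max that by blast
  qed
  then show ?thesis using a that by (auto simp: covers_def)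
qed

lemma max_chain_covers_unique:
  assumes "C \<in> max_chains" "x \<in> C" "y \<in> C"
  shows "a \<lessdot> x \<Longrightarrow> a \<lessdot> y \<Longrightarrow> x = y" and "x \<lessdot> b \<Longrightarrow> y \<lessdot> b \<Longrightarrow> x = y"
  using max_chain_comparable[OF assms] by (auto simp: covers_def order_le_less)

text \<open>
  An element of one chain that is missing from the other is incomparable with some element of the
  other, by maximality, and \<open>\<gamma>\<close> forces that element to be below \<open>\<gamma>\<close> too.
\<close>

lemma max_chains_incomparable_below:
  assumes C: "C \<in> max_chains" "\<gamma> \<in> C" and D: "D \<in> max_chains" "\<gamma> \<in> D"
    and "C \<inter> {..\<gamma>} \<noteq> D \<inter> {..\<gamma>}"
  obtains x y where "x \<in> C" "x < \<gamma>" "y \<in> D" "y < \<gamma>" "\<not> comparable x y"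
proof -
  have *: "\<exists>x\<in>C. \<exists>y\<in>D. x < \<gamma> \<and> y < \<gamma> \<and> \<not> comparable x y"
    if D: "D \<in> max_chains" "\<gamma> \<in> D" and x: "x \<in> C" "x \<le> \<gamma>" "x \<notin> D" for C D and x :: 'a
  proof -
    obtain y where y: "y \<in> D" "\<not> comparable x y"
      using max_chain_mem[OF D(1), of x] x by (auto simp: comparable_def)
    have "y < \<gamma>" using max_chain_comparable[OF D(1) y(1) D(2)] y x
      by (auto simp: comparable_def order_le_less dest: order_less_trans)
    then show ?thesis using x y D by (auto simp: order_le_less)
  qed
  consider x where "x \<in> C" "x \<le> \<gamma>" "x \<notin> D" | x where "x \<in> D" "x \<le> \<gamma>" "x \<notin> C"
    using assms(5) by auto
  then show ?thesis
  proof cases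
    case 1 then show ?thesis using *[OF D, of _ C] that by blast
  next
    case 2 then show ?thesis using *[OF C, of _ D] that by (auto simp: comparable_def)
  qed
qed

lemma max_chains_incomparable_above:
  assumes C: "C \<in> max_chains" "\<gamma> \<in> C" and D: "D \<in> max_chains" "\<gamma> \<in> D"
    and "C \<inter> {\<gamma>..} \<noteq> D \<inter> {\<gamma>..}"
  obtains x y where "x \<in> C" "\<gamma> < x" "y \<in> D" "\<gamma> < y" "\<not> comparable x y"
proof -
  have *: "\<exists>x\<in>C. \<exists>y\<in>D. \<gamma> < x \<and> \<gamma> < y \<and> \<not> comparable x y"
    if D: "D \<in> max_chains" "\<gamma> \<in> D" and x: "x \<in> C" "\<gamma> \<le> x" "x \<notin> D" for C D and x :: 'a
  proof -
    obtain y where y: "y \<in> D" "\<not> comparable x y"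
      using max_chain_mem[OF D(1), of x] x by (auto simp: comparable_def)
    have "\<gamma> < y" using max_chain_comparable[OF D(1) y(1) D(2)] y x
      by (auto simp: comparable_def order_le_less dest: order_less_trans)
    then show ?thesis using x y D by (auto simp: order_le_less)
  qed
  consider x where "x \<in> C" "\<gamma> \<le> x" "x \<notin> D" | x where "x \<in> D" "\<gamma> \<le> x" "x \<notin> C"
    using assms(5) by auto
  then show ?thesis
  proof cases
    case 1 then show ?thesis using *[OF D, of _ C] that by blast
  next
    case 2 then show ?thesis using *[OF C, of _ D] that by (auto simp: comparable_def)
  qed
qed

text \<open>
  This reduces statements about stars to statements about a common element of two chains: the swap
  at \<open>\<gamma>\<close> is nontrivial only if both parts differ, and then it belongs to a guided star.
\<close>

lemma obtain_guided_star:
  assumes \<C>: "\<C> \<subseteq> max_chains" and C: "C \<in> \<C>" "\<gamma> \<in> C" and D: "D \<in> \<C>" "\<gamma> \<in> D"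
    and "C \<inter> {..\<gamma>} \<noteq> D \<inter> {..\<gamma>}" "C \<inter> {\<gamma>..} \<noteq> D \<inter> {\<gamma>..}"
  obtains \<alpha>\<^sub>1 \<beta>\<^sub>1 \<alpha>\<^sub>2 \<beta>\<^sub>2 where "guided_star \<C> \<alpha>\<^sub>1 \<beta>\<^sub>1 \<alpha>\<^sub>2 \<beta>\<^sub>2"
    "C \<in> chains_through \<C> \<alpha>\<^sub>1 \<beta>\<^sub>1" "D \<in> chains_through \<C> \<alpha>\<^sub>2 \<beta>\<^sub>2"
    "\<gamma> \<in> (C \<inter> {\<alpha>\<^sub>1<..<\<beta>\<^sub>1}) \<inter> (D \<inter> {\<alpha>\<^sub>2<..<\<beta>\<^sub>2})"
proof -
  have max: "C \<in> max_chains" "D \<in> max_chains" using assms by auto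
  obtain \<alpha>\<^sub>1 \<alpha>\<^sub>2 where \<alpha>: "\<alpha>\<^sub>1 \<in> C" "\<alpha>\<^sub>1 < \<gamma>" "\<alpha>\<^sub>2 \<in> D" "\<alpha>\<^sub>2 < \<gamma>" "\<not> comparable \<alpha>\<^sub>1 \<alpha>\<^sub>2"
    using max_chains_incomparable_below[OF max(1) C(2) max(2) D(2)] assms by metis
  obtain \<beta>\<^sub>1 \<beta>\<^sub>2 where \<beta>: "\<beta>\<^sub>1 \<in> C" "\<gamma> < \<beta>\<^sub>1" "\<beta>\<^sub>2 \<in> D" "\<gamma> < \<beta>\<^sub>2" "\<not> comparable \<beta>\<^sub>1 \<beta>\<^sub>2"
    using max_chains_incomparable_above[OF max(1) C(2) max(2) D(2)] assms by metis
  have through: "C \<in> chains_through \<C> \<alpha>\<^sub>1 \<beta>\<^sub>1" "D \<in> chains_through \<C> \<alpha>\<^sub>2 \<beta>\<^sub>2"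
    using C D \<alpha> \<beta> by (auto simp: chains_through_def)
  have mid: "\<gamma> \<in> (C \<inter> {\<alpha>\<^sub>1<..<\<beta>\<^sub>1}) \<inter> (D \<inter> {\<alpha>\<^sub>2<..<\<beta>\<^sub>2})" using C D \<alpha> \<beta> by auto
  have "guided_star \<C> \<alpha>\<^sub>1 \<beta>\<^sub>1 \<alpha>\<^sub>2 \<beta>\<^sub>2"
    unfolding guided_star_def using \<alpha> \<beta> through mid order_less_trans by blast
  then show ?thesis using through mid by (rule that)
qed

lemma swap_closed_if_stars_complete:
  assumes \<C>: "\<C> \<subseteq> max_chains"
    and complete: "\<And>\<alpha>\<^sub>1 \<beta>\<^sub>1 \<alpha>\<^sub>2 \<beta>\<^sub>2. guided_star \<C> \<alpha>\<^sub>1 \<beta>\<^sub>1 \<alpha>\<^sub>2 \<beta>\<^sub>2 \<Longrightarrow> star_complete \<C> \<alpha>\<^sub>1 \<beta>\<^sub>1 \<alpha>\<^sub>2 \<beta>\<^sub>2"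
    and C: "C \<in> \<C>" "\<gamma> \<in> C" and D: "D \<in> \<C>" "\<gamma> \<in> D"
  shows "(C \<inter> {..\<gamma>}) \<union> (D \<inter> {\<gamma>..}) \<in> \<C>"
proof -
  have split: "X = (X \<inter> {..\<gamma>}) \<union> (X \<inter> {\<gamma>..})" if "X \<in> \<C>" "\<gamma> \<in> X" for X
    using that \<C> max_chain_comparable[of X _ \<gamma>] by auto
  consider "C \<inter> {..\<gamma>} = D \<inter> {..\<gamma>}" | "C \<inter> {\<gamma>..} = D \<inter> {\<gamma>..}"
    | "C \<inter> {..\<gamma>} \<noteq> D \<inter> {..\<gamma>}" "C \<inter> {\<gamma>..} \<noteq> D \<inter> {\<gamma>..}" by blast
  then show ?thesis
  proof cases
    case 1
    then show ?thesis using split[OF D] D by simp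
  next
    case 2
    then show ?thesis using split[OF C] C by simp
  next
    case 3
    obtain \<alpha>\<^sub>1 \<beta>\<^sub>1 \<alpha>\<^sub>2 \<beta>\<^sub>2 where "guided_star \<C> \<alpha>\<^sub>1 \<beta>\<^sub>1 \<alpha>\<^sub>2 \<beta>\<^sub>2"
      "C \<in> chains_through \<C> \<alpha>\<^sub>1 \<beta>\<^sub>1" "D \<in> chains_through \<C> \<alpha>\<^sub>2 \<beta>\<^sub>2"
      "\<gamma> \<in> (C \<inter> {\<alpha>\<^sub>1<..<\<beta>\<^sub>1}) \<inter> (D \<inter> {\<alpha>\<^sub>2<..<\<beta>\<^sub>2})"
      by (rule obtain_guided_star[OF \<C> C D 3])
    then have "(C \<inter> {..\<gamma>}) \<union> (D \<inter> {\<gamma><..}) \<in> \<C>"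
      using complete unfolding star_complete_def by blast
    moreover have "(C \<inter> {..\<gamma>}) \<union> (D \<inter> {\<gamma><..}) = (C \<inter> {..\<gamma>}) \<union> (D \<inter> {\<gamma>..})"
      using C by (auto simp: order_le_less)
    ultimately show ?thesis by simp
  qed
qed

text \<open>
  A swap-closed family contains every path through the covering pairs it uses: each initial
  segment of \<open>D\<close> is an initial segment of some member, because a member that agrees with \<open>D\<close> up to
  \<open>y\<close> can be swapped at \<open>y\<close> with a member using the next covering pair of \<open>D\<close>.
\<close>

lemma max_chain_mem_if_covers_used:
  fixes \<C> :: "'a::{finite,order} set set"
  assumes \<C>: "\<C> \<subseteq> max_chains"
    and swap: "\<And>C D \<gamma>. C \<in> \<C> \<Longrightarrow> D \<in> \<C> \<Longrightarrow> \<gamma> \<in> C \<Longrightarrow> \<gamma> \<in> D \<Longrightarrow>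
      (C \<inter> {..\<gamma>}) \<union> (D \<inter> {\<gamma>..}) \<in> \<C>"
    and D: "D \<in> max_chains"
    and vertices: "\<And>x. x \<in> D \<Longrightarrow> chains_through \<C> x x \<noteq> {}"
    and edges: "\<And>x y. x \<in> D \<Longrightarrow> y \<in> D \<Longrightarrow> x \<lessdot> y \<Longrightarrow> chains_through \<C> x y \<noteq> {}"
  shows "D \<in> \<C>"
proof -
  have prefix: "\<exists>C\<in>\<C>. x \<in> C \<and> C \<inter> {..x} = D \<inter> {..x}" if "x \<in> D" for x
    using that
  proof (induction "card {..<x}" arbitrary: x rule: less_induct)
    case less
    show ?case
    proof (cases "\<exists>z. z < x")
      case False
      then have single: "X \<inter> {..x} = {x}" if "x \<in> X" for X using that by (auto simp: order_le_less)
      obtain C where C: "C \<in> \<C>" "x \<in> C" using vertices[OF less.prems] by (auto simp: chains_through_def)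
      then have "C \<inter> {..x} = D \<inter> {..x}" using single[OF C(2)] single[OF less.prems] by simp
      then show ?thesis using C by blast
    next
      case True
      then obtain y where y: "y \<in> D" "y \<lessdot> x" using max_chain_lower_cover[OF D less.prems] by blast
      then have "{..<y} \<subset> {..<x}" by (auto simp: covers_def dest: order_less_trans)
      then have "card {..<y} < card {..<x}" by (simp add: psubset_card_mono)
      then obtain C where C: "C \<in> \<C>" "y \<in> C" "C \<inter> {..y} = D \<inter> {..y}"
        using less.hyps[OF _ y(1)] by blast
      obtain E where E: "E \<in> \<C>" "y \<in> E" "x \<in> E"
        using edges[OF y(1) less.prems y(2)] by (auto simp: chains_through_def)
      define F where "F = (C \<inter> {..y}) \<union> (E \<inter> {y..})"
      have "F \<in> \<C>" unfolding F_def using C E by (intro swap) auto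
      have gap: "z = y \<or> z = x" if "y \<le> z" "z \<le> x" for z
        using that y by (auto simp: covers_def order_le_less)
      have "y \<le> x" using y by (auto simp: covers_def)
      have "F \<inter> {..x} = insert x (D \<inter> {..y})"
      proof (intro equalityI subsetI)
        fix z assume "z \<in> F \<inter> {..x}"
        then show "z \<in> insert x (D \<inter> {..y})" using gap[of z] C unfolding F_def by auto
      next
        fix z assume "z \<in> insert x (D \<inter> {..y})"
        then consider "z = x" | "z \<in> C \<inter> {..y}" using C(3) by blast
        then show "z \<in> F \<inter> {..x}"
          using E \<open>y \<le> x\<close> unfolding F_def by cases (auto dest: order_trans[of z y x])
      qed
      also have "\<dots> = D \<inter> {..x}"
      proof (intro equalityI subsetI)
        fix z assume "z \<in> insert x (D \<inter> {..y})"
        then show "z \<in> D \<inter> {..x}" using less.prems \<open>y \<le> x\<close> order_trans[of z y x] by auto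
      next
        fix z assume "z \<in> D \<inter> {..x}"
        then show "z \<in> insert x (D \<inter> {..y})"
          using gap[of z] max_chain_comparable[OF D y(1), of z] y(1) by auto
      qed
      finally show ?thesis using \<open>F \<in> \<C>\<close> less.prems by blast
    qed
  qed
  obtain x where x: "x \<in> D" "\<And>y. y \<in> D \<Longrightarrow> x \<le> y \<Longrightarrow> x = y"
    using finite_has_maximal[of D] max_chain_nonempty[OF D] by auto
  have top: "\<not> x < z" for z
  proof
    assume "x < z"
    then obtain b where "b \<in> D" "x \<lessdot> b" using max_chain_upper_cover[OF D x(1)] by blast
    then show False using x(2)[of b] by (auto simp: covers_def order_le_less)
  qed
  have below: "X \<inter> {..x} = X" if X: "X \<in> max_chains" "x \<in> X" for X
  proof -
    have "y \<le> x" if "y \<in> X" for y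
      using max_chain_comparable[OF X(1) that X(2)] top[of y] by (auto simp: order_le_less)
    then show ?thesis by blast
  qed
  obtain C where C: "C \<in> \<C>" "x \<in> C" "C \<inter> {..x} = D \<inter> {..x}" using prefix[OF x(1)] by blast
  then have "C \<in> max_chains" using \<C> by blast
  then have "C = D" using below[OF D x(1)] below[OF _ C(2)] C(3) by simp
  then show ?thesis using C by simp
qed

section \<open>Chain polytopes and their faces\<close>

lemma subset_vector_nth: "subset_vector Q $ x = of_bool (x \<in> Q)"
  by (simp add: subset_vector_def axis_def)

lemma inj_subset_vector: "inj subset_vector"
  by (rule injI) (auto simp: vec_eq_iff subset_vector_nth of_bool_eq_iff)

text \<open>
  The vector of a subset is a vertex of the unit cube, which contains the polytope.
\<close>

lemma subset_vector_extreme: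
  fixes \<Q> :: "'a::finite set set"
  assumes "Q \<in> \<Q>"
  shows "subset_vector Q extreme_point_of conv \<Q>"
proof -
  have "convex (cbox 0 (1 :: real ^ 'a))" by (rule convex_box)
  then have cube: "conv \<Q> \<subseteq> cbox 0 1"
    unfolding conv_def by (intro hull_minimal) (auto simp: mem_box_cart subset_vector_nth)
  have False if pq: "p \<in> conv \<Q>" "q \<in> conv \<Q>" "subset_vector Q \<in> open_segment p q" for p q
  proof -
    obtain t where t: "0 < t" "t < 1" "p \<noteq> q"
      and Q: "subset_vector Q = (1 - t) *\<^sub>R p + t *\<^sub>R q"
      using pq(3) by (auto simp: in_segment)
    have "p $ x = q $ x" for x
    proof -
      have p: "0 \<le> p $ x" "p $ x \<le> 1" and q: "0 \<le> q $ x" "q $ x \<le> 1"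
        using pq(1,2) cube by (auto simp: subset_iff mem_box_cart)
      have eq: "(1 - t) * p $ x + t * q $ x = of_bool (x \<in> Q)"
        using arg_cong[OF Q, of "\<lambda>v. v $ x"] by (simp add: subset_vector_nth)
      show ?thesis
      proof (cases "x \<in> Q")
        case True
        then have "(1 - t) * (1 - p $ x) + t * (1 - q $ x) = 0"
          using eq by (simp add: algebra_simps)
        moreover have "(1 - t) * (1 - p $ x) \<ge> 0" "t * (1 - q $ x) \<ge> 0" using t p q by auto
        ultimately have "(1 - t) * (1 - p $ x) = 0" "t * (1 - q $ x) = 0" by linarith+
        then show ?thesis using t by simp
      next
        case False
        then have "(1 - t) * p $ x + t * q $ x = 0" using eq by simp
        moreover have "(1 - t) * p $ x \<ge> 0" "t * q $ x \<ge> 0" using t p q by auto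
        ultimately have "(1 - t) * p $ x = 0" "t * q $ x = 0" by linarith+
        then show ?thesis using t by simp
      qed
    qed
    then show False using \<open>p \<noteq> q\<close> by (simp add: vec_eq_iff)
  qed
  moreover have "subset_vector Q \<in> conv \<Q>" using assms by (auto simp: conv_def intro: hull_inc)
  ultimately show ?thesis by (auto simp: extreme_point_of_def)
qed

lemma subset_vector_mem_conv_iff: "subset_vector Q \<in> conv \<Q> \<longleftrightarrow> Q \<in> \<Q>"
proof
  assume Q: "subset_vector Q \<in> conv \<Q>"
  have "conv \<Q> \<subseteq> conv (insert Q \<Q>)" unfolding conv_def by (intro hull_mono) auto
  then have "subset_vector Q extreme_point_of conv \<Q>"
    using Q subset_vector_extreme[of Q "insert Q \<Q>"] by (auto simp: extreme_point_of_def)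
  then have "subset_vector Q \<in> subset_vector ` \<Q>"
    unfolding conv_def by (rule extreme_point_of_convex_hull)
  then show "Q \<in> \<Q>" using inj_subset_vector by (auto dest: injD)
qed (auto simp: conv_def intro: hull_inc)

text \<open>
  The extreme points of \<open>conv \<Q>\<close> are exactly the vectors of the members of \<open>\<Q>\<close>, so these are the only
  possible vertices of a simplex.
\<close>

lemma simplex_conv_iff:
  fixes \<Q> :: "'a::finite set set"
  shows "n simplex conv \<Q> \<longleftrightarrow> \<not> affine_dependent (subset_vector ` \<Q>) \<and> n = int (card \<Q>) - 1"
proof
  assume "n simplex conv \<Q>"
  then obtain K where K: "\<not> affine_dependent K" "int (card K) = n + 1" "conv \<Q> = convex hull K"
    by (auto simp: simplex_def)
  have "subset_vector ` \<Q> \<subseteq> K"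
    using subset_vector_extreme[of _ \<Q>] extreme_point_of_convex_hull_affine_independent[OF K(1)]
    by (auto simp: K(3))
  moreover have "K \<subseteq> subset_vector ` \<Q>"
    using extreme_point_of_convex_hull_affine_independent[OF K(1)] extreme_point_of_convex_hull
    by (auto simp flip: K(3) simp: conv_def)
  ultimately have "K = subset_vector ` \<Q>" by blast
  moreover have "card (subset_vector ` \<Q>) = card \<Q>"
    using inj_subset_vector by (intro card_image) (auto intro: inj_on_subset)
  ultimately show "\<not> affine_dependent (subset_vector ` \<Q>) \<and> n = int (card \<Q>) - 1"
    using K by simp
next
  assume *: "\<not> affine_dependent (subset_vector ` \<Q>) \<and> n = int (card \<Q>) - 1"
  moreover have "card (subset_vector ` \<Q>) = card \<Q>"
    using inj_subset_vector by (intro card_image) (auto intro: inj_on_subset)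
  ultimately show "n simplex conv \<Q>" unfolding simplex_def conv_def by fastforce
qed

lemma affine_independent_subset_vectors_iff:
  fixes \<Q> :: "'a::finite set set"
  shows "\<not> affine_dependent (subset_vector ` \<Q>) \<longleftrightarrow>
     (\<forall>\<nu>. (\<Sum>Q\<in>\<Q>. \<nu> Q) = 0 \<and> (\<Sum>Q\<in>\<Q>. \<nu> Q *\<^sub>R subset_vector Q) = 0 \<longrightarrow> (\<forall>Q\<in>\<Q>. \<nu> Q = 0))"
    (is "?L \<longleftrightarrow> ?R")
proof -
  have inj: "inj_on subset_vector \<Q>" using inj_subset_vector by (rule inj_on_subset) simp
  have dep: "affine_dependent (subset_vector ` \<Q>) \<longleftrightarrow>
      (\<exists>U. (\<Sum>Q\<in>\<Q>. U (subset_vector Q)) = 0 \<and> (\<exists>Q\<in>\<Q>. U (subset_vector Q) \<noteq> 0) \<and>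
        (\<Sum>Q\<in>\<Q>. U (subset_vector Q) *\<^sub>R subset_vector Q) = 0)"
    by (subst affine_dependent_explicit_finite) (auto simp: sum.reindex[OF inj])
  show ?thesis
  proof
    assume L: ?L
    show ?R
    proof (intro allI impI)
      fix \<nu> :: "'a set \<Rightarrow> real"
      assume "(\<Sum>Q\<in>\<Q>. \<nu> Q) = 0 \<and> (\<Sum>Q\<in>\<Q>. \<nu> Q *\<^sub>R subset_vector Q) = 0"
      then show "\<forall>Q\<in>\<Q>. \<nu> Q = 0"
        using L unfolding dep
        by (auto dest!: spec[of _ "\<lambda>v. \<nu> (the_inv subset_vector v)"]
            simp: the_inv_f_f[OF inj_subset_vector])
    qed
  next
    assume ?R then show ?L unfolding dep by blast
  qed
qed

lemma face_of_sum_mem: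
  assumes F: "F face_of S" and S: "convex S" and "finite I"
    and p: "\<And>i. i \<in> I \<Longrightarrow> p i \<in> S" and w: "\<And>i. i \<in> I \<Longrightarrow> w i > 0" "sum w I = 1"
    and mem: "(\<Sum>i\<in>I. w i *\<^sub>R p i) \<in> F" and j: "j \<in> I"
  shows "p j \<in> F"
proof (cases "I = {j}")
  case True
  then show ?thesis using mem w by simp
next
  case False
  define r where "r = sum w (I - {j})"
  define y where "y = (\<Sum>i\<in>I - {j}. (w i / r) *\<^sub>R p i)"
  have "r > 0" unfolding r_def using False j w \<open>finite I\<close> by (intro sum_pos) auto
  have wj: "w j = 1 - r" using w(2) j \<open>finite I\<close> by (simp add: r_def sum_diff1)
  have "y \<in> S" unfolding y_def
    using p w(1) \<open>r > 0\<close> \<open>finite I\<close>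
    by (intro convex_sum[OF _ S]) (auto simp: r_def less_imp_le simp flip: sum_divide_distrib)
  have split: "(\<Sum>i\<in>I. w i *\<^sub>R p i) = (1 - r) *\<^sub>R p j + r *\<^sub>R y"
    using \<open>r > 0\<close> j \<open>finite I\<close> wj
    by (simp add: y_def scaleR_right.sum sum.remove[of I j])
  show ?thesis
  proof (cases "p j = y")
    case True
    then show ?thesis using mem split by (simp flip: scaleR_left_distrib)
  next
    case False
    have "(\<Sum>i\<in>I. w i *\<^sub>R p i) \<in> open_segment (p j) y"
      unfolding in_segment split using False \<open>r > 0\<close> wj w(1)[OF j] by (auto intro!: exI[of _ r])
    then show ?thesis using face_ofD[OF F _ p[OF j] \<open>y \<in> S\<close> mem] by blast
  qed
qed

text \<open>
  The barycentre of the first family lies in the face and equals the barycentre of the second.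
\<close>

lemma face_exchange:
  fixes C D :: "'i \<Rightarrow> 'a::finite set"
  assumes face: "conv \<C> face_of conv \<Q>" and I: "finite I"
    and C: "\<And>i. i \<in> I \<Longrightarrow> C i \<in> \<C>" and D: "\<And>i. i \<in> I \<Longrightarrow> D i \<in> \<Q>"
    and eq: "(\<Sum>i\<in>I. subset_vector (C i)) = (\<Sum>i\<in>I. subset_vector (D i))" and j: "j \<in> I"
  shows "D j \<in> \<C>"
proof -
  let ?w = "1 / real (card I)"
  have pos: "card I > 0" using I j by (auto simp: card_gt_0_iff)
  have conv: "convex (conv X)" for X :: "'a set set" by (simp add: conv_def)
  have "(\<Sum>i\<in>I. ?w *\<^sub>R subset_vector (C i)) \<in> conv \<C>"
    using I C pos by (intro convex_sum[OF _ conv]) (auto simp: subset_vector_mem_conv_iff)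
  then have "(\<Sum>i\<in>I. ?w *\<^sub>R subset_vector (D i)) \<in> conv \<C>"
    using eq by (simp flip: scaleR_right.sum)
  then have "subset_vector (D j) \<in> conv \<C>"
    using pos D j by (intro face_of_sum_mem[OF face conv I]) (auto simp: subset_vector_mem_conv_iff)
  then show ?thesis by (simp add: subset_vector_mem_conv_iff)
qed

text \<open>
  For an affinely independent family, each chain occurs equally often on both sides of the exchange.
  The function \<open>\<phi>\<close> serves to show that an exchange is nontrivial: a \<open>\<phi>\<close> with different
  sums refutes independence.
\<close>

lemma affine_independent_exchange:
  fixes C D :: "'i \<Rightarrow> 'a::finite set" and \<phi> :: "'a set \<Rightarrow> real"
  assumes indep: "\<not> affine_dependent (subset_vector ` \<C>)" and I: "finite I"
    and C: "\<And>i. i \<in> I \<Longrightarrow> C i \<in> \<C>" and D: "\<And>i. i \<in> I \<Longrightarrow> D i \<in> \<C>"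
    and eq: "(\<Sum>i\<in>I. subset_vector (C i)) = (\<Sum>i\<in>I. subset_vector (D i))"
  shows "(\<Sum>i\<in>I. \<phi> (C i)) = (\<Sum>i\<in>I. \<phi> (D i))"
proof -
  define m where "m E X = real (card {i \<in> I. E i = X})" for E :: "'i \<Rightarrow> 'a set" and X
  have count: "(\<Sum>X\<in>\<C>. m E X *\<^sub>R f X) = (\<Sum>i\<in>I. f (E i))" if "\<And>i. i \<in> I \<Longrightarrow> E i \<in> \<C>"
    for E and f :: "'a set \<Rightarrow> 'v::real_vector"
  proof -
    have "(\<Sum>X\<in>\<C>. m E X *\<^sub>R f X) = (\<Sum>X\<in>\<C>. \<Sum>i | i \<in> I \<and> E i = X. f (E i))"
      by (intro sum.cong refl) (simp add: m_def sum_constant_scaleR)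
    also have "\<dots> = (\<Sum>i\<in>I. f (E i))" using I that by (intro sum.group) auto
    finally show ?thesis .
  qed
  have "(\<Sum>X\<in>\<C>. m C X - m D X) = 0"
    using count[of C "\<lambda>_. 1::real", OF C] count[of D "\<lambda>_. 1::real", OF D]
    by (simp add: sum_subtractf)
  moreover have "(\<Sum>X\<in>\<C>. (m C X - m D X) *\<^sub>R subset_vector X) = 0"
    using count[of C subset_vector, OF C] count[of D subset_vector, OF D] eq
    by (simp add: scaleR_left_diff_distrib sum_subtractf)
  ultimately have "\<forall>X\<in>\<C>. m C X - m D X = 0"
    using indep unfolding affine_independent_subset_vectors_iff
    by (elim allE[of _ "\<lambda>X. m C X - m D X"]) blast
  then have "(\<Sum>X\<in>\<C>. m C X *\<^sub>R \<phi> X) = (\<Sum>X\<in>\<C>. m D X *\<^sub>R \<phi> X)" by (intro sum.cong) auto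
  then show ?thesis using count[of C \<phi>, OF C] count[of D \<phi>, OF D] by simp
qed

text \<open>
  By \<open>face_of_convex_hulls\<close> it suffices that the affine hull of the vectors of \<open>\<C>\<close> misses the convex
  hull of the others. A common point gives coefficients \<open>\<nu>\<close> that are convex coefficients outside
  \<open>\<C>\<close> and negated affine coefficients on \<open>\<C>\<close>.
\<close>

lemma face_of_conv_criterion:
  fixes \<C> :: "'a::finite set set"
  assumes sub: "\<C> \<subseteq> \<Q>"
    and rigid: "\<And>\<nu> D. (\<Sum>Q\<in>\<Q>. \<nu> Q *\<^sub>R subset_vector Q) = 0 \<Longrightarrow>
      (\<And>Q. Q \<in> \<Q> - \<C> \<Longrightarrow> \<nu> Q \<ge> 0) \<Longrightarrow> D \<in> \<Q> - \<C> \<Longrightarrow> \<nu> D > 0 \<Longrightarrow> False"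
  shows "conv \<C> face_of conv \<Q>"
  unfolding conv_def
proof (rule face_of_convex_hulls)
  have inj: "inj_on subset_vector X" for X :: "'a set set"
    using inj_subset_vector by (rule inj_on_subset) simp
  have diff: "subset_vector ` \<Q> - subset_vector ` \<C> = subset_vector ` (\<Q> - \<C>)"
    using inj_subset_vector by (rule image_set_diff[symmetric])
  show "affine hull (subset_vector ` \<C>) \<inter> convex hull (subset_vector ` \<Q> - subset_vector ` \<C>) = {}"
  proof (rule ccontr)
    assume "\<not> ?thesis"
    then obtain x where "x \<in> affine hull (subset_vector ` \<C>)"
      and "x \<in> convex hull (subset_vector ` (\<Q> - \<C>))" by (auto simp: diff)
    then obtain u w where u: "(\<Sum>C\<in>\<C>. u (subset_vector C) *\<^sub>R subset_vector C) = x"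
      and w: "\<And>D. D \<in> \<Q> - \<C> \<Longrightarrow> w (subset_vector D) \<ge> (0::real)"
        "(\<Sum>D\<in>\<Q> - \<C>. w (subset_vector D)) = 1"
        "(\<Sum>D\<in>\<Q> - \<C>. w (subset_vector D) *\<^sub>R subset_vector D) = x"
      by (auto simp: affine_hull_finite convex_hull_finite sum.reindex[OF inj])
    define \<nu> where "\<nu> X = (if X \<in> \<C> then - u (subset_vector X) else w (subset_vector X))" for X
    have "(\<Sum>Q\<in>\<Q>. \<nu> Q *\<^sub>R subset_vector Q)
        = (\<Sum>Q\<in>\<Q> - \<C>. \<nu> Q *\<^sub>R subset_vector Q) + (\<Sum>Q\<in>\<C>. \<nu> Q *\<^sub>R subset_vector Q)"
      using sub by (intro sum.subset_diff) auto
    also have "(\<Sum>Q\<in>\<Q> - \<C>. \<nu> Q *\<^sub>R subset_vector Q) = x"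
      by (subst w(3)[symmetric], rule sum.cong) (auto simp: \<nu>_def)
    also have "(\<Sum>Q\<in>\<C>. \<nu> Q *\<^sub>R subset_vector Q) = - x"
      using u by (simp add: \<nu>_def sum_negf)
    finally have zero: "(\<Sum>Q\<in>\<Q>. \<nu> Q *\<^sub>R subset_vector Q) = 0" by simp
    obtain D where D: "D \<in> \<Q> - \<C>" "w (subset_vector D) \<noteq> 0"
      using w(2) sum.neutral[of "\<Q> - \<C>"] by (metis zero_neq_one)
    then show False using rigid[OF zero, of D] w(1) by (force simp: \<nu>_def)
  qed
qed (use sub in auto)

section \<open>Guided crowns and stars as exchanges of chains\<close>

lemma bij_betw_pred_index: "bij_betw (pred_index \<rho>) {1..\<rho>} {1..\<rho>}"
  by (rule bij_betw_byWitness[where f' = "\<lambda>i. if i = \<rho> then 1 else Suc i"])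
    (auto simp: pred_index_def)

lemma sum_pred_index: "(\<Sum>i\<in>{1..\<rho>}. f (pred_index \<rho> i)) = (\<Sum>i\<in>{1..\<rho>}. f i)"
  using sum.reindex_bij_betw[OF bij_betw_pred_index] .

definition crown_exchange ::
    "nat \<Rightarrow> (nat \<Rightarrow> 'a::order) \<Rightarrow> (nat \<Rightarrow> 'a) \<Rightarrow> (nat \<Rightarrow> 'a set) \<Rightarrow> nat \<Rightarrow> 'a set" where
  "crown_exchange \<rho> \<alpha> \<beta> C i =
     (C i \<inter> {..\<alpha> i}) \<union> (C (pred_index \<rho> i) \<inter> {\<beta> (pred_index \<rho> i)..})"

context
  fixes \<C> :: "'a::{finite,order} set set" and \<rho> \<alpha> \<beta> C
  assumes \<C>: "\<C> \<subseteq> max_chains" and crown: "guided_crown \<C> \<rho> \<alpha> \<beta>"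
    and C: "\<And>i. i \<in> {1..\<rho>} \<Longrightarrow> C i \<in> chains_through \<C> (\<alpha> i) (\<beta> i)"
begin

lemma crown_index: "i \<in> {1..\<rho>} \<Longrightarrow> pred_index \<rho> i \<in> {1..\<rho>}"
  using bij_betwE[OF bij_betw_pred_index] by blast

lemma crown_chain:
  assumes "i \<in> {1..\<rho>}"
  shows "C i \<in> max_chains" "\<alpha> i \<in> C i" "\<beta> i \<in> C i" "\<alpha> i \<lessdot> \<beta> i" "\<alpha> i \<lessdot> \<beta> (pred_index \<rho> i)"
  using C[OF assms] \<C> crown assms by (auto simp: chains_through_def guided_crown_def)

lemma crown_exchange_max_chain: "i \<in> {1..\<rho>} \<Longrightarrow> crown_exchange \<rho> \<alpha> \<beta> C i \<in> max_chains"
  unfolding crown_exchange_def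
  using crown_chain crown_index by (intro splice_max_chain) auto

text \<open>
  Both sides consist of the same lower parts \<open>L i\<close> and upper parts \<open>U i\<close>, attached to each other with
  the upper parts shifted by one index.
\<close>

lemma crown_exchange_sum:
  "(\<Sum>i\<in>{1..\<rho>}. subset_vector (C i)) = (\<Sum>i\<in>{1..\<rho>}. subset_vector (crown_exchange \<rho> \<alpha> \<beta> C i))"
proof -
  define L where "L i = C i \<inter> {..\<alpha> i}" for i
  define U where "U i = C i \<inter> {\<beta> i..}" for i
  have disjoint_sum: "subset_vector (L i \<union> U j) = subset_vector (L i) + subset_vector (U j)"
    if "\<alpha> i \<lessdot> \<beta> j" for i j
    using that by (auto simp: vec_eq_iff subset_vector_nth L_def U_def covers_def)
  have "(\<Sum>i\<in>{1..\<rho>}. subset_vector (C i)) = (\<Sum>i\<in>{1..\<rho>}. subset_vector (L i) + subset_vector (U i))"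
  proof (rule sum.cong)
    fix i assume i: "i \<in> {1..\<rho>}"
    have "C i = L i \<union> U i"
      unfolding L_def U_def by (rule max_chain_split[OF crown_chain(1-4)[OF i]])
    then show "subset_vector (C i) = subset_vector (L i) + subset_vector (U i)"
      using disjoint_sum[OF crown_chain(4)[OF i]] by simp
  qed simp
  also have "\<dots> = (\<Sum>i\<in>{1..\<rho>}. subset_vector (L i) + subset_vector (U (pred_index \<rho> i)))"
    by (simp only: sum.distrib sum_pred_index[of "\<lambda>i. subset_vector (U i)"])
  also have "\<dots> = (\<Sum>i\<in>{1..\<rho>}. subset_vector (crown_exchange \<rho> \<alpha> \<beta> C i))"
    using crown_chain disjoint_sum
    by (intro sum.cong refl) (simp add: crown_exchange_def L_def U_def)
  finally show ?thesis .
qed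

text \<open>
  Besides the covering pairs inside the parts \<open>L i\<close> and \<open>U i\<close>, the old chains use the pairs
  \<open>(\<alpha> i, \<beta> i)\<close> and the new ones the pairs \<open>(\<alpha> i, \<beta> (pred_index \<rho> i))\<close>. As the crown has no repeated
  elements, \<open>(\<alpha> 1, \<beta> 1)\<close> is not among the latter, so it is used once more before the exchange. The
  exchange is thus nontrivial even if some new chains coincide with old ones.
\<close>

lemma crown_exchange_edge_count:
  defines "\<phi> \<equiv> \<lambda>X. of_bool (\<alpha> 1 \<in> X \<and> \<beta> 1 \<in> X) :: real"
  shows "(\<Sum>i\<in>{1..\<rho>}. \<phi> (C i)) \<noteq> (\<Sum>i\<in>{1..\<rho>}. \<phi> (crown_exchange \<rho> \<alpha> \<beta> C i))"
proof -
  define L where "L i = C i \<inter> {..\<alpha> i}" for i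
  define U where "U i = C i \<inter> {\<beta> i..}" for i
  have \<rho>: "\<rho> \<ge> 2" "1 \<in> {1..\<rho>}" using crown by (auto simp: guided_crown_def)
  have edge: "\<alpha> 1 \<lessdot> \<beta> 1" using crown_chain(4)[OF \<rho>(2)] .
  have count: "\<phi> (L i \<union> U j) = \<phi> (L i) + \<phi> (U j) + of_bool (\<alpha> i = \<alpha> 1 \<and> \<beta> j = \<beta> 1)"
    if ij: "i \<in> {1..\<rho>}" "j \<in> {1..\<rho>}" "\<alpha> i \<lessdot> \<beta> j" for i j
  proof -
    have *: "\<alpha> i < \<beta> j" "\<alpha> i \<in> L i" "\<beta> j \<in> U j"
      using crown_chain ij by (auto simp: L_def U_def covers_def)
    have "\<alpha> i = \<alpha> 1 \<and> \<beta> j = \<beta> 1" if "\<alpha> 1 \<in> L i" "\<beta> 1 \<in> U j"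
    proof -
      have "\<alpha> 1 \<le> \<alpha> i" "\<beta> j \<le> \<beta> 1" using that by (auto simp: L_def U_def)
      then show ?thesis using edge *(1) unfolding covers_def
        by (metis order_le_less order_less_le_trans order_le_less_trans)
    qed
    moreover have "\<not> (\<alpha> 1 \<in> U j \<and> \<beta> 1 \<in> L i)"
      using edge *(1) by (auto simp: L_def U_def covers_def dest: order_trans)
    moreover have "x \<notin> U j" if "x \<in> L i" for x
      using that *(1) by (auto simp: L_def U_def dest: order_trans)
    ultimately show ?thesis using *(2,3) unfolding \<phi>_def by (auto simp: of_bool_def)
  qed
  have inj: "\<alpha> i = \<alpha> 1 \<longleftrightarrow> i = 1" "\<beta> i = \<beta> 1 \<longleftrightarrow> i = 1" if "i \<in> {1..\<rho>}" for i
    using crown \<rho> that unfolding guided_crown_def by blast+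
  have old: "\<phi> (C i) = \<phi> (L i) + \<phi> (U i) + of_bool (i = 1)" if "i \<in> {1..\<rho>}" for i
    using count[OF that that crown_chain(4)[OF that]] inj[OF that]
      max_chain_split[OF crown_chain(1-4)[OF that]] by (simp add: L_def U_def)
  have new: "\<phi> (crown_exchange \<rho> \<alpha> \<beta> C i) = \<phi> (L i) + \<phi> (U (pred_index \<rho> i))"
    if "i \<in> {1..\<rho>}" for i
    using count[OF that crown_index[OF that] crown_chain(5)[OF that]]
      inj(1)[OF that] inj(2)[OF crown_index[OF that]] \<rho>(1)
    by (auto simp: crown_exchange_def L_def U_def pred_index_def split: if_splits)
  have "(\<Sum>i\<in>{1..\<rho>}. \<phi> (C i)) = (\<Sum>i\<in>{1..\<rho>}. \<phi> (L i) + \<phi> (U i)) + (\<Sum>i\<in>{1..\<rho>}. of_bool (i = 1))"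
    using old by (simp add: sum.distrib)
  also have "(\<Sum>i\<in>{1..\<rho>}. of_bool (i = 1)) = (1::real)"
    using \<rho> by (simp add: of_bool_def)
  also have "(\<Sum>i\<in>{1..\<rho>}. \<phi> (L i) + \<phi> (U i)) = (\<Sum>i\<in>{1..\<rho>}. \<phi> (L i) + \<phi> (U (pred_index \<rho> i)))"
    by (simp only: sum.distrib sum_pred_index[of "\<lambda>i. \<phi> (U i)"])
  also have "\<dots> = (\<Sum>i\<in>{1..\<rho>}. \<phi> (crown_exchange \<rho> \<alpha> \<beta> C i))"
    using new by (intro sum.cong) auto
  finally show ?thesis by simp
qed

end

lemma crown_complete_if_face:
  fixes \<C> :: "'a::{finite,order} set set"
  assumes \<C>: "\<C> \<subseteq> max_chains" and face: "conv \<C> face_of max_chain_polytope"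
    and crown: "guided_crown \<C> \<rho> \<alpha> \<beta>"
  shows "crown_complete \<C> \<rho> \<alpha> \<beta>"
  unfolding crown_complete_def
proof (intro ballI)
  fix i C C'
  let ?j = "pred_index \<rho> i"
  assume i: "i \<in> {1..\<rho>}" and C: "C \<in> chains_through \<C> (\<alpha> i) (\<beta> i)"
    and C': "C' \<in> chains_through \<C> (\<alpha> ?j) (\<beta> ?j)"
  have "?j \<noteq> i" using crown i by (auto simp: guided_crown_def pred_index_def)
  define E where "E k = (if k = i then C else if k = ?j then C'
    else (SOME X. X \<in> chains_through \<C> (\<alpha> k) (\<beta> k)))" for k
  have E: "E k \<in> chains_through \<C> (\<alpha> k) (\<beta> k)" if "k \<in> {1..\<rho>}" for k
    using C C' crown that by (auto simp: E_def guided_crown_def some_in_eq)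
  have "crown_exchange \<rho> \<alpha> \<beta> E i \<in> \<C>"
  proof (rule face_exchange[OF face[unfolded max_chain_polytope_def] _ _ _
        crown_exchange_sum[OF \<C> crown E] i])
    show "E k \<in> \<C>" if "k \<in> {1..\<rho>}" for k using E[OF that] by (simp add: chains_through_def)
  qed (use crown_exchange_max_chain[OF \<C> crown E] in auto)
  then show "(C \<inter> {..\<alpha> i}) \<union> (C' \<inter> {\<beta> ?j..}) \<in> \<C>"
    using \<open>?j \<noteq> i\<close> by (simp add: crown_exchange_def E_def)
qed

lemma affine_dependent_if_complete_crown:
  fixes \<C> :: "'a::{finite,order} set set"
  assumes \<C>: "\<C> \<subseteq> max_chains"
    and crown: "guided_crown \<C> \<rho> \<alpha> \<beta>" and complete: "crown_complete \<C> \<rho> \<alpha> \<beta>"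
  shows "affine_dependent (subset_vector ` \<C>)"
proof (rule ccontr)
  assume indep: "\<not> affine_dependent (subset_vector ` \<C>)"
  have "\<forall>i. \<exists>X. i \<in> {1..\<rho>} \<longrightarrow> X \<in> chains_through \<C> (\<alpha> i) (\<beta> i)"
    using crown unfolding guided_crown_def by blast
  then obtain C where C: "\<And>i. i \<in> {1..\<rho>} \<Longrightarrow> C i \<in> chains_through \<C> (\<alpha> i) (\<beta> i)" by metis
  have "crown_exchange \<rho> \<alpha> \<beta> C i \<in> \<C>" if "i \<in> {1..\<rho>}" for i
    using complete C[OF that] C[OF crown_index[OF \<C> crown C that]] that
    unfolding crown_complete_def crown_exchange_def by blast
  moreover have "C i \<in> \<C>" if "i \<in> {1..\<rho>}" for i using C[OF that] by (simp add: chains_through_def)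
  ultimately have eq: "(\<Sum>i\<in>{1..\<rho>}. \<phi> (C i)) = (\<Sum>i\<in>{1..\<rho>}. \<phi> (crown_exchange \<rho> \<alpha> \<beta> C i))"
    for \<phi> :: "'a set \<Rightarrow> real"
    by (intro affine_independent_exchange[OF indep] crown_exchange_sum[OF \<C> crown C]) auto
  show False
    by (rule notE[OF crown_exchange_edge_count[OF \<C> crown C]
          eq[of "\<lambda>X. of_bool (\<alpha> 1 \<in> X \<and> \<beta> 1 \<in> X)"]])
qed

lemma swap_sum:
  assumes "C \<in> max_chains" "D \<in> max_chains" "\<gamma> \<in> C" "\<gamma> \<in> D"
  shows "subset_vector C + subset_vector D =
    subset_vector ((C \<inter> {..\<gamma>}) \<union> (D \<inter> {\<gamma><..})) + subset_vector ((D \<inter> {..\<gamma>}) \<union> (C \<inter> {\<gamma><..}))"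
proof -
  have "x \<le> \<gamma> \<or> \<gamma> < x" if "x \<in> C \<or> x \<in> D" for x
    using that assms max_chain_comparable[of _ x \<gamma>] by (auto simp: order_le_less)
  then show ?thesis
    by (auto simp: vec_eq_iff subset_vector_nth of_bool_def dest: order_le_less_trans)
qed

lemma swap_max_chain:
  assumes "C \<in> max_chains" "D \<in> max_chains" "\<gamma> \<in> C" "\<gamma> \<in> D"
  shows "(C \<inter> {..\<gamma>}) \<union> (D \<inter> {\<gamma><..}) \<in> max_chains"
proof -
  have "(C \<inter> {..\<gamma>}) \<union> (D \<inter> {\<gamma><..}) = (C \<inter> {..\<gamma>}) \<union> (D \<inter> {\<gamma>..})"
    using assms by (auto simp: order_le_less)
  then show ?thesis using splice_max_chain[OF assms(1,3,2,4)] by simp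
qed

lemma star_complete_if_face:
  fixes \<C> :: "'a::{finite,order} set set"
  assumes \<C>: "\<C> \<subseteq> max_chains" and face: "conv \<C> face_of max_chain_polytope"
  shows "star_complete \<C> \<alpha>\<^sub>1 \<beta>\<^sub>1 \<alpha>\<^sub>2 \<beta>\<^sub>2"
proof -
  \<comment> \<open>The two chains and their swaps are families indexed by the two truth values.\<close>
  have swap: "(C \<inter> {..\<gamma>}) \<union> (D \<inter> {\<gamma><..}) \<in> \<C>" if "C \<in> \<C>" "D \<in> \<C>" "\<gamma> \<in> C" "\<gamma> \<in> D" for C D \<gamma>
  proof -
    have max: "C \<in> max_chains" "D \<in> max_chains" using that \<C> by auto
    show ?thesis
      using face_exchange[OF face[unfolded max_chain_polytope_def], of UNIV "\<lambda>b. if b then C else D"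
          "\<lambda>b. if b then (C \<inter> {..\<gamma>}) \<union> (D \<inter> {\<gamma><..}) else (D \<inter> {..\<gamma>}) \<union> (C \<inter> {\<gamma><..})" True]
        swap_sum[OF max] swap_max_chain[OF max] swap_max_chain[OF max(2,1)] that
      by (auto simp: UNIV_bool add.commute)
  qed
  show ?thesis unfolding star_complete_def chains_through_def using swap by blast
qed

lemma affine_dependent_if_complete_star:
  fixes \<C> :: "'a::{finite,order} set set"
  assumes \<C>: "\<C> \<subseteq> max_chains"
    and star: "guided_star \<C> \<alpha>\<^sub>1 \<beta>\<^sub>1 \<alpha>\<^sub>2 \<beta>\<^sub>2" and complete: "star_complete \<C> \<alpha>\<^sub>1 \<beta>\<^sub>1 \<alpha>\<^sub>2 \<beta>\<^sub>2"
  shows "affine_dependent (subset_vector ` \<C>)"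
proof (rule ccontr)
  assume indep: "\<not> affine_dependent (subset_vector ` \<C>)"
  obtain C D \<gamma> where C: "C \<in> \<C>" "\<alpha>\<^sub>1 \<in> C" "\<beta>\<^sub>1 \<in> C" and D: "D \<in> \<C>" "\<alpha>\<^sub>2 \<in> D" "\<beta>\<^sub>2 \<in> D"
    and \<gamma>: "\<gamma> \<in> (C \<inter> {\<alpha>\<^sub>1<..<\<beta>\<^sub>1}) \<inter> (D \<inter> {\<alpha>\<^sub>2<..<\<beta>\<^sub>2})"
    and inc: "\<not> comparable \<alpha>\<^sub>1 \<alpha>\<^sub>2" "\<not> comparable \<beta>\<^sub>1 \<beta>\<^sub>2"
    using star unfolding guided_star_def chains_through_def by blast
  let ?E = "(C \<inter> {..\<gamma>}) \<union> (D \<inter> {\<gamma><..})" and ?F = "(D \<inter> {..\<gamma>}) \<union> (C \<inter> {\<gamma><..})"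
  have mem: "?E \<in> \<C>" "?F \<in> \<C>"
    using complete C D \<gamma> unfolding star_complete_def chains_through_def by blast+
  have max: "C \<in> max_chains" "D \<in> max_chains" using C D \<C> by auto
  have "\<beta>\<^sub>2 \<notin> C" "\<alpha>\<^sub>2 \<notin> C" using max_chain_comparable[OF max(1)] C inc by (auto simp: comparable_def)
  moreover have "\<beta>\<^sub>2 \<in> ?E" "\<alpha>\<^sub>2 \<in> ?F" using D \<gamma> by auto
  \<comment> \<open>So the chain \<open>C\<close> occurs on the old side of the exchange but not on the new one.\<close>
  ultimately have "?E \<noteq> C" "?F \<noteq> C" by blast+
  moreover have "(\<Sum>b\<in>UNIV. of_bool ((if b then C else D) = C) :: real)
      = (\<Sum>b\<in>UNIV. of_bool ((if b then ?E else ?F) = C))"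
  proof (rule affine_independent_exchange[OF indep, where \<phi> = "\<lambda>X. of_bool (X = C)"])
    show "(\<Sum>b\<in>UNIV. subset_vector (if b then C else D))
        = (\<Sum>b\<in>UNIV. subset_vector (if b then ?E else ?F))"
      using swap_sum[OF max, of \<gamma>] \<gamma> by (simp add: UNIV_bool add.commute)
  qed (simp_all add: mem C D)
  ultimately show False by (simp add: UNIV_bool)
qed

section \<open>The edge flow of a linear relation between chains\<close>

definition edge_flow :: "'a::order set set \<Rightarrow> ('a set \<Rightarrow> real) \<Rightarrow> 'a \<Rightarrow> 'a \<Rightarrow> real" where
  "edge_flow \<Q> \<nu> x y = (if x \<lessdot> y then sum \<nu> (chains_through \<Q> x y) else 0)"

context
  fixes \<Q> :: "'a::{finite,order} set set" and \<nu> :: "'a set \<Rightarrow> real"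
  assumes \<Q>: "\<Q> \<subseteq> max_chains" and relation: "(\<Sum>Q\<in>\<Q>. \<nu> Q *\<^sub>R subset_vector Q) = 0"
begin

lemma vertex_flow_zero: "sum \<nu> (chains_through \<Q> x x) = 0"
proof -
  have "sum \<nu> (chains_through \<Q> x x) = (\<Sum>Q\<in>\<Q>. \<nu> Q * of_bool (x \<in> Q))"
    by (auto simp: chains_through_def of_bool_def sum.inter_filter intro!: sum.cong)
  also have "\<dots> = (\<Sum>Q\<in>\<Q>. \<nu> Q *\<^sub>R subset_vector Q) $ x"
    by (simp add: sum_component subset_vector_nth)
  finally show ?thesis using relation by simp
qed

text \<open>
  Each chain through a non-maximal \<open>x\<close> passes to exactly one upper cover of \<open>x\<close>, so the row sum is the
  total weight at \<open>x\<close>.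
\<close>

lemma edge_flow_row: "(\<Sum>y\<in>UNIV. edge_flow \<Q> \<nu> x y) = 0"
proof (cases "\<exists>z. x < z")
  case False
  then show ?thesis by (auto simp: edge_flow_def covers_def intro: sum.neutral)
next
  case True
  then have cover: "\<exists>y\<in>Q. x \<lessdot> y" if "Q \<in> \<Q>" "x \<in> Q" for Q
    using max_chain_upper_cover[of Q x] that \<Q> by blast
  have "(\<Sum>y\<in>UNIV. edge_flow \<Q> \<nu> x y) = (\<Sum>y | x \<lessdot> y. sum \<nu> (chains_through \<Q> x y))"
    by (simp add: edge_flow_def sum.If_cases)
  also have "\<dots> = sum \<nu> (\<Union>y\<in>{y. x \<lessdot> y}. chains_through \<Q> x y)"
    using \<Q> max_chain_covers_unique(1)
    by (intro sum.UNION_disjoint[symmetric]) (auto simp: chains_through_def, blast)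
  also have "(\<Union>y\<in>{y. x \<lessdot> y}. chains_through \<Q> x y) = chains_through \<Q> x x"
    using cover by (auto simp: chains_through_def)
  finally show ?thesis using vertex_flow_zero by simp
qed

lemma edge_flow_column: "(\<Sum>x\<in>UNIV. edge_flow \<Q> \<nu> x y) = 0"
proof (cases "\<exists>z. z < y")
  case False
  then show ?thesis by (auto simp: edge_flow_def covers_def intro: sum.neutral)
next
  case True
  then have cover: "\<exists>x\<in>Q. x \<lessdot> y" if "Q \<in> \<Q>" "y \<in> Q" for Q
    using max_chain_lower_cover[of Q y] that \<Q> by blast
  have "(\<Sum>x\<in>UNIV. edge_flow \<Q> \<nu> x y) = (\<Sum>x | x \<lessdot> y. sum \<nu> (chains_through \<Q> x y))"
    by (simp add: edge_flow_def sum.If_cases)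
  also have "\<dots> = sum \<nu> (\<Union>x\<in>{x. x \<lessdot> y}. chains_through \<Q> x y)"
    using \<Q> max_chain_covers_unique(2)
    by (intro sum.UNION_disjoint[symmetric]) (auto simp: chains_through_def, blast)
  also have "(\<Union>x\<in>{x. x \<lessdot> y}. chains_through \<Q> x y) = chains_through \<Q> y y"
    using cover by (auto simp: chains_through_def)
  finally show ?thesis using vertex_flow_zero by simp
qed

text \<open>
  The cycle through the positive entry alternates with negative entries, and a negative entry
  must come from a chain of negative weight, which lies in \<open>\<C>\<close>: these chains guide the crown.
\<close>

lemma positive_edge_in_guided_crown:
  assumes neg: "\<And>Q. Q \<in> \<Q> - \<C> \<Longrightarrow> \<nu> Q \<ge> 0" and pos: "edge_flow \<Q> \<nu> x y > 0"
  obtains \<rho> \<alpha> \<beta> where "guided_crown \<C> \<rho> \<alpha> \<beta>" "\<alpha> 1 = x" "\<beta> \<rho> = y"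
proof -
  obtain \<rho> \<alpha> \<beta> where \<rho>: "\<rho> \<ge> 2" and ends: "\<alpha> 1 = x" "\<beta> \<rho> = y"
    and down: "\<And>i. i \<in> {1..\<rho>} \<Longrightarrow> edge_flow \<Q> \<nu> (\<alpha> i) (\<beta> i) < 0"
    and up: "\<And>i. i \<in> {1..\<rho>} \<Longrightarrow> edge_flow \<Q> \<nu> (\<alpha> i) (\<beta> (pred_index \<rho> i)) > 0"
    and inj: "inj_on \<alpha> {1..\<rho>}" "inj_on \<beta> {1..\<rho>}"
    using alternating_cycle[of "edge_flow \<Q> \<nu>", OF edge_flow_row edge_flow_column pos] by metis
  have "chains_through \<C> (\<alpha> i) (\<beta> i) \<noteq> {}" if "i \<in> {1..\<rho>}" for i
  proof -
    have "sum \<nu> (chains_through \<Q> (\<alpha> i) (\<beta> i)) < 0"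
      using down[OF that] by (simp add: edge_flow_def split: if_splits)
    then obtain Q where "Q \<in> chains_through \<Q> (\<alpha> i) (\<beta> i)" "\<nu> Q < 0"
      by (meson not_less sum_nonneg)
    then show ?thesis using neg[of Q] by (force simp: chains_through_def)
  qed
  moreover have "\<alpha> i \<lessdot> \<beta> i" "\<alpha> i \<lessdot> \<beta> (pred_index \<rho> i)" if "i \<in> {1..\<rho>}" for i
    using down[OF that] up[OF that] by (auto simp: edge_flow_def split: if_splits)
  ultimately have "guided_crown \<C> \<rho> \<alpha> \<beta>"
    using \<rho> inj unfolding guided_crown_def inj_on_def by blast
  then show ?thesis using ends that by blast
qed

end

section \<open>Complete structures give faces\<close>

text \<open>
  If \<open>D\<close> has positive weight and uses a covering pair unused by \<open>\<C>\<close>, only nonnegative weights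
  contribute to that pair, so its flow is positive and it is a pair \<open>\<alpha> 1 \<lessdot> \<beta> \<rho>\<close> of a guided crown.
  Completeness of the crown then produces a chain of \<open>\<C>\<close> through it.
\<close>

lemma face_if_complete:
  fixes \<C> :: "'a::{finite,order} set set"
  assumes \<C>: "\<C> \<subseteq> max_chains"
    and crowns: "\<And>\<rho> \<alpha> \<beta>. guided_crown \<C> \<rho> \<alpha> \<beta> \<Longrightarrow> crown_complete \<C> \<rho> \<alpha> \<beta>"
    and stars: "\<And>\<alpha>\<^sub>1 \<beta>\<^sub>1 \<alpha>\<^sub>2 \<beta>\<^sub>2. guided_star \<C> \<alpha>\<^sub>1 \<beta>\<^sub>1 \<alpha>\<^sub>2 \<beta>\<^sub>2 \<Longrightarrow> star_complete \<C> \<alpha>\<^sub>1 \<beta>\<^sub>1 \<alpha>\<^sub>2 \<beta>\<^sub>2"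
  shows "conv \<C> face_of max_chain_polytope"
  unfolding max_chain_polytope_def
proof (rule face_of_conv_criterion[OF \<C>])
  fix \<nu> and D :: "'a set"
  assume relation: "(\<Sum>Q\<in>max_chains. \<nu> Q *\<^sub>R subset_vector Q) = 0"
    and nonneg: "\<And>Q. Q \<in> max_chains - \<C> \<Longrightarrow> \<nu> Q \<ge> 0"
    and D: "D \<in> max_chains - \<C>" "\<nu> D > 0"
  have pos: "sum \<nu> (chains_through max_chains x y) > 0"
    if "x \<in> D" "y \<in> D" "chains_through \<C> x y = {}" for x y
    using that D nonneg by (intro sum_pos2[of _ D]) (auto simp: chains_through_def)
  have "D \<in> \<C>"
  proof (rule max_chain_mem_if_covers_used[OF \<C> swap_closed_if_stars_complete[OF \<C> stars]])
    show "chains_through \<C> x x \<noteq> {}" if "x \<in> D" for x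
      using pos[OF that that] vertex_flow_zero[OF _ relation, of x] by auto
    show "chains_through \<C> x y \<noteq> {}" if xy: "x \<in> D" "y \<in> D" "x \<lessdot> y" for x y
    proof
      assume empty: "chains_through \<C> x y = {}"
      then have "edge_flow max_chains \<nu> x y > 0" using pos[OF xy(1,2)] xy(3) by (simp add: edge_flow_def)
      then obtain \<rho> \<alpha> \<beta> where crown: "guided_crown \<C> \<rho> \<alpha> \<beta>" "\<alpha> 1 = x" "\<beta> \<rho> = y"
        using positive_edge_in_guided_crown[OF _ relation nonneg] by blast
      then have one: "1 \<in> {1..\<rho>}" "\<rho> \<in> {1..\<rho>}" "pred_index \<rho> 1 = \<rho>"
        by (auto simp: guided_crown_def pred_index_def)
      then obtain C C' where C: "C \<in> chains_through \<C> (\<alpha> 1) (\<beta> 1)" "C' \<in> chains_through \<C> (\<alpha> \<rho>) (\<beta> \<rho>)"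
        using crown(1) unfolding guided_crown_def by blast
      then have "(C \<inter> {..\<alpha> 1}) \<union> (C' \<inter> {\<beta> \<rho>..}) \<in> \<C>"
        using crowns[OF crown(1)] one unfolding crown_complete_def by metis
      then have "(C \<inter> {..\<alpha> 1}) \<union> (C' \<inter> {\<beta> \<rho>..}) \<in> chains_through \<C> x y"
        using C crown(2,3) by (auto simp: chains_through_def)
      then show False using empty by blast
    qed
  qed (use D in auto)
  then show False using D by blast
qed

section \<open>Absence of crowns and stars gives affine independence\<close>

text \<open>
  Without stars, each \<open>x \<in> C\<close> determines the lower part or the upper part of every member of \<open>\<C>\<close>
  through \<open>x\<close>. The bottom of \<open>C\<close> determines the lower part. At the last element \<open>a\<close> that does so,
  either \<open>a\<close> is the top of \<open>C\<close>, or its successor in \<open>C\<close> determines the upper part; so \<open>a\<close>, or \<open>a\<close>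
  together with its successor, determines all of \<open>C\<close>.
\<close>

lemma private_vertex_or_edge:
  fixes \<C> :: "'a::{finite,order} set set"
  assumes \<C>: "\<C> \<subseteq> max_chains"
    and no_star: "\<And>\<alpha>\<^sub>1 \<beta>\<^sub>1 \<alpha>\<^sub>2 \<beta>\<^sub>2. \<not> guided_star \<C> \<alpha>\<^sub>1 \<beta>\<^sub>1 \<alpha>\<^sub>2 \<beta>\<^sub>2"
    and C: "C \<in> \<C>"
  obtains x y where "x = y \<or> x \<lessdot> y" "chains_through \<C> x y = {C}"
proof -
  have max: "X \<in> max_chains" if "X \<in> \<C>" for X using that \<C> by blast
  \<comment> \<open>\<open>low x\<close> and \<open>upp x\<close>: passing through \<open>x\<close> forces agreement with \<open>C\<close> below, respectively above, \<open>x\<close>.\<close>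
  define low where "low x \<longleftrightarrow> (\<forall>X\<in>\<C>. x \<in> X \<longrightarrow> X \<inter> {..x} = C \<inter> {..x})" for x
  define upp where "upp x \<longleftrightarrow> (\<forall>X\<in>\<C>. x \<in> X \<longrightarrow> X \<inter> {x..} = C \<inter> {x..})" for x
  have agree: "X \<inter> {..x} = Y \<inter> {..x} \<or> X \<inter> {x..} = Y \<inter> {x..}"
    if "X \<in> \<C>" "Y \<in> \<C>" "x \<in> X" "x \<in> Y" for X Y x
    using obtain_guided_star[OF \<C> that(1,3,2,4)] no_star by metis
  have low_or_upp: "low x \<or> upp x" if x: "x \<in> C" for x
  proof (rule ccontr)
    assume "\<not> (low x \<or> upp x)"
    then obtain X Y where X: "X \<in> \<C>" "x \<in> X" "X \<inter> {..x} \<noteq> C \<inter> {..x}"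
      and Y: "Y \<in> \<C>" "x \<in> Y" "Y \<inter> {x..} \<noteq> C \<inter> {x..}" by (auto simp: low_def upp_def)
    then show False
      \<comment> \<open>\<open>X\<close> agrees with \<open>C\<close> above \<open>x\<close> and \<open>Y\<close> below, hence \<open>X\<close> and \<open>Y\<close> differ on both sides.\<close>
      using agree[OF X(1) C X(2) x] agree[OF Y(1) C Y(2) x] agree[OF X(1) Y(1) X(2) Y(2)] by simp
  qed
  have through: "C \<in> chains_through \<C> x y" if "x \<in> C" "y \<in> C" for x y
    using C that by (simp add: chains_through_def)
  obtain m where m: "m \<in> C" "\<And>y. y \<in> C \<Longrightarrow> y \<le> m \<Longrightarrow> m = y"
    using finite_has_minimal[of C] max_chain_nonempty[OF max[OF C]] by auto
  have "\<not> z < m" for z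
  proof
    assume "z < m"
    then obtain b where "b \<in> C" "b \<lessdot> m" using max_chain_lower_cover[OF max[OF C] m(1)] by blast
    then show False using m(2)[of b] by (auto simp: covers_def order_le_less)
  qed
  then have "X \<inter> {..m} = {m}" if "m \<in> X" for X using that by (auto simp: order_le_less)
  then have "low m" using m(1) by (simp add: low_def)
  then obtain a where a: "a \<in> C" "low a" "\<And>y. y \<in> C \<Longrightarrow> low y \<Longrightarrow> a \<le> y \<Longrightarrow> a = y"
    using finite_has_maximal[of "{x \<in> C. low x}"] m(1) by auto
  show ?thesis
  proof (cases "\<exists>z. a < z")
    case False
    have "X \<inter> {..a} = X" if X: "X \<in> \<C>" "a \<in> X" for X
    proof -
      have "y \<le> a" if "y \<in> X" for y
        using max_chain_comparable[OF max[OF X(1)] that X(2)] False by (auto simp: order_le_less)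
      then show ?thesis by blast
    qed
    then have "X = C" if "X \<in> \<C>" "a \<in> X" for X
      using a C that unfolding low_def by metis
    then have "chains_through \<C> a a = {C}"
      using through[of a a] a(1) unfolding chains_through_def by blast
    then show ?thesis using that by blast
  next
    case True
    then obtain b where b: "b \<in> C" "a \<lessdot> b" using max_chain_upper_cover[OF max[OF C] a(1)] by blast
    then have "upp b" using a(3)[of b] low_or_upp[OF b(1)] by (auto simp: covers_def order_le_less)
    have "X = C" if X: "X \<in> \<C>" "a \<in> X" "b \<in> X" for X
      using max_chain_split[OF max[OF X(1)] X(2,3) b(2)] max_chain_split[OF max[OF C] a(1) b]
        \<open>low a\<close> \<open>upp b\<close> X unfolding low_def upp_def by metis
    then have "chains_through \<C> a b = {C}"
      using through[of a b] a(1) b unfolding chains_through_def by blast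
    then show ?thesis using that b by blast
  qed
qed

lemma affine_independent_if_no_structure:
  fixes \<C> :: "'a::{finite,order} set set"
  assumes \<C>: "\<C> \<subseteq> max_chains"
    and no_crown: "\<And>\<rho> \<alpha> \<beta>. \<not> guided_crown \<C> \<rho> \<alpha> \<beta>"
    and no_star: "\<And>\<alpha>\<^sub>1 \<beta>\<^sub>1 \<alpha>\<^sub>2 \<beta>\<^sub>2. \<not> guided_star \<C> \<alpha>\<^sub>1 \<beta>\<^sub>1 \<alpha>\<^sub>2 \<beta>\<^sub>2"
  shows "\<not> affine_dependent (subset_vector ` \<C>)"
  unfolding affine_independent_subset_vectors_iff
proof (intro allI impI ballI)
  fix \<nu> C
  assume "(\<Sum>Q\<in>\<C>. \<nu> Q) = 0 \<and> (\<Sum>Q\<in>\<C>. \<nu> Q *\<^sub>R subset_vector Q) = 0" and C: "C \<in> \<C>"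
  then have relation: "(\<Sum>Q\<in>\<C>. \<nu> Q *\<^sub>R subset_vector Q) = 0" by simp
  have nonpos: "edge_flow \<C> \<nu> x y \<le> 0" for x y
    using positive_edge_in_guided_crown[OF \<C> relation, of \<C> x y] no_crown by fastforce
  have flow: "edge_flow \<C> \<nu> x y = 0" for x y
  proof -
    have "(\<Sum>z\<in>UNIV. - edge_flow \<C> \<nu> x z) = 0"
      using edge_flow_row[OF \<C> relation, of x] by (simp add: sum_negf)
    then show ?thesis
      using nonpos sum_nonneg_eq_0_iff[of UNIV "\<lambda>z. - edge_flow \<C> \<nu> x z"] by simp
  qed
  obtain x y where "x = y \<or> x \<lessdot> y" and own: "chains_through \<C> x y = {C}"
    by (rule private_vertex_or_edge[OF \<C> no_star C])
  then consider "x = y" | "x \<lessdot> y" by blast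
  then show "\<nu> C = 0"
  proof cases
    case 1
    then show ?thesis using vertex_flow_zero[OF \<C> relation, of x] own by simp
  next
    case 2
    then show ?thesis using flow[of x y] own by (simp add: edge_flow_def)
  qed
qed

theorem theorem2p14:
  fixes \<C> :: "'a::{finite,order} set set"
  assumes "\<C> \<noteq> {}" and "\<C> \<subseteq> max_chains"
  shows "(((int (card \<C>) - 1) simplex conv \<C> \<and> conv \<C> face_of max_chain_polytope)
            \<longleftrightarrow> \<not> guided_crown_structure \<C>) \<and>
         (((\<nexists>n. n simplex conv \<C>) \<and> conv \<C> face_of max_chain_polytope)
            \<longleftrightarrow> complete_guided_crown_structure \<C>) \<and>
         (\<not> conv \<C> face_of max_chain_polytope
            \<longleftrightarrow> incomplete_guided_crown_structure \<C>)"
proof -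
  note \<C> = assms(2)
  let ?face = "conv \<C> face_of max_chain_polytope"
  let ?indep = "\<not> affine_dependent (subset_vector ` \<C>)"
  have face: "?face \<longleftrightarrow>
     (\<forall>\<rho> \<alpha> \<beta>. guided_crown \<C> \<rho> \<alpha> \<beta> \<longrightarrow> crown_complete \<C> \<rho> \<alpha> \<beta>) \<and>
     (\<forall>\<alpha>\<^sub>1 \<beta>\<^sub>1 \<alpha>\<^sub>2 \<beta>\<^sub>2. guided_star \<C> \<alpha>\<^sub>1 \<beta>\<^sub>1 \<alpha>\<^sub>2 \<beta>\<^sub>2 \<longrightarrow> star_complete \<C> \<alpha>\<^sub>1 \<beta>\<^sub>1 \<alpha>\<^sub>2 \<beta>\<^sub>2)"
    using face_if_complete[OF \<C>] crown_complete_if_face[OF \<C>] star_complete_if_face[OF \<C>] by blast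
  have face_indep: "?indep \<longleftrightarrow> \<not> guided_crown_structure \<C>" if ?face
    using that affine_independent_if_no_structure[OF \<C>] affine_dependent_if_complete_crown[OF \<C>]
      affine_dependent_if_complete_star[OF \<C>]
    unfolding face guided_crown_structure_def by blast
  have no_structure_face: ?face if "\<not> guided_crown_structure \<C>"
    using that unfolding face guided_crown_structure_def by blast
  have simplex: "(int (card \<C>) - 1) simplex conv \<C> \<longleftrightarrow> ?indep" "(\<nexists>n. n simplex conv \<C>) \<longleftrightarrow> \<not> ?indep"
    by (auto simp: simplex_conv_iff)
  have complete: "complete_guided_crown_structure \<C> \<longleftrightarrow> guided_crown_structure \<C> \<and> ?face"
    unfolding complete_guided_crown_structure_def face by blast
  show ?thesis
    unfolding simplex complete incomplete_guided_crown_structure_def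
    using face_indep no_structure_face by blast
qed

end
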